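(* Let $K$ be a field, $G$ a finite groupoid and $B$ a left weak $KG$-module algebra. Then there exist a subalgebra $S$ of $B\sharp KG\sharp KG^{*}$ that contains a unital subalgebra $S'$ such that $S=S'\oplus T$ as $K$-algebras (for some $T$), and an ideal $D$ of $B\sharp KG\sharp KG^{*}$ such that $B\sharp KG\sharp KG^{*}=D\oplus S$.
   Context: Groupoids: $G$ is a finite groupoid, with partially defined product, set of identities $G_0$, source $s(g)=gg^{-1}$ and target $t(g)=g^{-1}g$. The product $gh$ exists iff $t(g)=s(h)$, and $G_2=\{(g,h)\in G\times G: t(g)=s(h)\}$. Groupoid algebra: $KG$ is the $K$-vector space with basis $\{u_g: g\in G\}$ and product $u_gu_h=u_{gh}$ if $(g,h)\in G_2$, and $0$ otherwise. It is a weak Hopf algebra with unit $1_{KG}=\sum_{e\in G_0}u_e$, $\Delta(u_g)=u_g\otimes u_g$, $\epsilon(u_g)=1$, $S(u_g)=u_{g^{-1}}$. The map $\epsilon_t$ is $\epsilon_t(x)=\epsilon(1_1x)1_2$, where $\Delta(1)=1_1\otimes 1_2$ (Sweedler notation). Dual: $KG^*$ is the dual weak Hopf algebra with dual basis $\{\rho_g:g\in G\}$, convolution product $(f*f')(u_\sigma)=f(u_\sigma)f'(u_\sigma)$, and $\Delta(\rho_h)=\sum_{t(k)=t(h)}\rho_{hk^{-1}}\otimes\rho_k$. A left weak $KG$-module algebra is a unital $K$-algebra $B$ that is a left $KG$-module with $\sigma.(ab)=(\sigma_1.a)(\sigma_2.b)$ and $\sigma.1_B=\epsilon_t(\sigma).1_B$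 for $\sigma\in KG$, $a,b\in B$. Write $g.a$ for $u_g.a$. Smash products (all tensor products are over $K$; these algebras are not necessarily unital, and a subalgebra is not required to contain a unit): $B\sharp KG=B\otimes_K KG$ with product $(a\sharp u_\sigma)(b\sharp u_\tau)=a(\sigma.b)\sharp u_\sigma u_\tau$. $KG^*$ acts on $B\sharp KG$ by $\rho_h\rightharpoonup(b\sharp u_l)=b\sharp\rho_h(u_l)u_l$. $B\sharp KG\sharp KG^*=B\otimes_K KG\otimes_K KG^*$ with product $$(a\sharp u_g\sharp\rho_h)(b\sharp u_{g'}\sharp\rho_{h'})=\sum_{t(k)=t(h)}(a\sharp u_g)\big(\rho_{hk^{-1}}\rightharpoonup(b\sharp u_{g'})\big)\sharp(\rho_k*\rho_{h'}).$$ *)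

theory Defs
  imports "HOL-Algebra.Module"
begin

section \<open>Finite groupoids\<close>

text \<open>The partially defined product is option-valued: \<open>pcomp G g h = None\<close> means that
  the product \<open>gh\<close> does not exist.\<close>

record 'g pgroupoid = "'g partial_object" +
  pcomp :: "'g \<Rightarrow> 'g \<Rightarrow> 'g option"
  ginv :: "'g \<Rightarrow> 'g"

locale groupoid =
  fixes G :: "'g pgroupoid" (structure)
  assumes pcomp_closed:
      "\<lbrakk>g \<in> carrier G; h \<in> carrier G; pcomp G g h = Some k\<rbrakk> \<Longrightarrow> k \<in> carrier G"
    and ginv_closed: "g \<in> carrier G \<Longrightarrow> ginv G g \<in> carrier G"
    and pcomp_assoc:
      "\<lbrakk>g \<in> carrier G; h \<in> carrier G; l \<in> carrier G\<rbrakk> \<Longrightarrow>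
        Option.bind (pcomp G g h) (\<lambda>x. pcomp G x l) = Option.bind (pcomp G h l) (pcomp G g)"
    and pcomp_assoc_defined:
      "\<lbrakk>g \<in> carrier G; h \<in> carrier G; l \<in> carrier G; pcomp G g h \<noteq> None; pcomp G h l \<noteq> None\<rbrakk>
        \<Longrightarrow> Option.bind (pcomp G g h) (\<lambda>x. pcomp G x l) \<noteq> None"
    and ginv_pcomp_defined:
      "g \<in> carrier G \<Longrightarrow> pcomp G g (ginv G g) \<noteq> None \<and> pcomp G (ginv G g) g \<noteq> None"
    and pcomp_ginv_cancel:
      "\<lbrakk>g \<in> carrier G; h \<in> carrier G; pcomp G g h = Some k\<rbrakk> \<Longrightarrow>
        pcomp G k (ginv G h) = Some g \<and> pcomp G (ginv G g) k = Some h"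

locale finite_groupoid = groupoid +
  assumes finite_arrows: "finite (carrier G)"

definition src :: "'g pgroupoid \<Rightarrow> 'g \<Rightarrow> 'g" where
  "src G g = the (pcomp G g (ginv G g))"

definition tgt :: "'g pgroupoid \<Rightarrow> 'g \<Rightarrow> 'g" where
  "tgt G g = the (pcomp G (ginv G g) g)"

definition identities :: "'g pgroupoid \<Rightarrow> 'g set" where
  "identities G = src G ` carrier G"


lemma (in groupoid) src_tgt_Some:
  assumes "g \<in> carrier G"
  shows "pcomp G g (ginv G g) = Some (src G g)" "pcomp G (ginv G g) g = Some (tgt G g)"
    "src G g \<in> carrier G" "tgt G g \<in> carrier G"
proof -
  show s: "pcomp G g (ginv G g) = Some (src G g)" and t: "pcomp G (ginv G g) g = Some (tgt G g)"
    using ginv_pcomp_defined[OF assms] by (auto simp: src_def tgt_def)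
  show "src G g \<in> carrier G" using pcomp_closed[OF assms ginv_closed[OF assms] s] .
  show "tgt G g \<in> carrier G" using pcomp_closed[OF ginv_closed[OF assms] assms t] .
qed

lemma (in groupoid) pcomp_tgt: 
  assumes g: "g \<in> carrier G" shows "pcomp G g (tgt G g) = Some g" "pcomp G (src G g) g = Some g"
proof -
  note st = src_tgt_Some[OF g] note gi = ginv_closed[OF g]
  have "pcomp G g (tgt G g) \<noteq> None"
    using pcomp_assoc[OF g gi g] pcomp_assoc_defined[OF g gi g] st by simp
  then obtain x where x: "pcomp G g (tgt G g) = Some x" by auto
  have "pcomp G (ginv G g) x = Some (tgt G g)" using pcomp_ginv_cancel[OF g st(4) x] by simp
  then have "pcomp G (ginv G (ginv G g)) (tgt G g) = Some x"
    using pcomp_ginv_cancel[OF gi pcomp_closed[OF g st(4) x]] by blast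
  moreover have "pcomp G (ginv G (ginv G g)) (tgt G g) = Some g"
    using pcomp_ginv_cancel[OF gi g st(2)] by blast
  ultimately show "pcomp G g (tgt G g) = Some g" using x by simp
  then show "pcomp G (src G g) g = Some g"
    using pcomp_assoc[OF g gi g] st by simp
qed

lemma (in groupoid) pcomp_defined_iff:
  assumes g: "g \<in> carrier G" and h: "h \<in> carrier G"
  shows "pcomp G g h \<noteq> None \<longleftrightarrow> tgt G g = src G h"
proof
  assume "pcomp G g h \<noteq> None"
  then obtain k where k: "pcomp G g h = Some k" by auto
  have "pcomp G (ginv G g) k = Some h" using pcomp_ginv_cancel[OF g h k] by blast
  then have "pcomp G (tgt G g) h = Some h"
    using pcomp_assoc[OF ginv_closed[OF g] g h] src_tgt_Some[OF g] k by simp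
  then show "tgt G g = src G h"
    using pcomp_ginv_cancel[OF src_tgt_Some(4)[OF g] h] src_tgt_Some(1)[OF h] by fastforce
next
  assume e: "tgt G g = src G h"
  show "pcomp G g h \<noteq> None"
    using pcomp_assoc_defined[OF g src_tgt_Some(4)[OF g] h] pcomp_tgt(1)[OF g] pcomp_tgt(2)[OF h] e
    by simp
qed


section \<open>The groupoid algebra as a weak Hopf algebra, and its dual\<close>

text \<open>An element of \<open>KG\<close> is its family of coordinates with respect to the basis \<open>u\<^sub>g\<close>.
  Likewise an element of \<open>KG \<otimes> KG\<close> is its family of coordinates with respect to the
  basis \<open>u\<^sub>g \<otimes> u\<^sub>h\<close>.\<close>

definition groupoid_algebra ::
    "('k, 'm) ring_scheme \<Rightarrow> 'g pgroupoid \<Rightarrow> ('k, 'g \<Rightarrow> 'k) module" where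
  "groupoid_algebra K G =
    \<lparr>carrier = carrier G \<rightarrow>\<^sub>E carrier K,
     monoid.mult = (\<lambda>x y. \<lambda>l\<in>carrier G.
       finsum K (\<lambda>(g, h). x g \<otimes>\<^bsub>K\<^esub> y h)
         {(g, h) \<in> carrier G \<times> carrier G. pcomp G g h = Some l}),
     one = (\<lambda>l\<in>carrier G. if l \<in> identities G then \<one>\<^bsub>K\<^esub> else \<zero>\<^bsub>K\<^esub>),
     zero = (\<lambda>l\<in>carrier G. \<zero>\<^bsub>K\<^esub>),
     add = (\<lambda>x y. \<lambda>l\<in>carrier G. x l \<oplus>\<^bsub>K\<^esub> y l),
     smult = (\<lambda>c x. \<lambda>l\<in>carrier G. c \<otimes>\<^bsub>K\<^esub> x l)\<rparr>"

definition ubasis :: "('k, 'm) ring_scheme \<Rightarrow> 'g pgroupoid \<Rightarrow> 'g \<Rightarrow> 'g \<Rightarrow> 'k" where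
  "ubasis K G g = (\<lambda>l\<in>carrier G. if l = g then \<one>\<^bsub>K\<^esub> else \<zero>\<^bsub>K\<^esub>)"

lemma ubasis_mult:
  assumes "ring K" "finite_groupoid G" "g \<in> carrier G" "h \<in> carrier G"
  shows "ubasis K G g \<otimes>\<^bsub>groupoid_algebra K G\<^esub> ubasis K G h =
    (case pcomp G g h of Some k \<Rightarrow> ubasis K G k | None \<Rightarrow> \<zero>\<^bsub>groupoid_algebra K G\<^esub>)"
proof -
  interpret ring K by fact
  interpret finite_groupoid G by fact
  show ?thesis
  proof (rule ext)
    fix l
    let ?S = "{(g, h) \<in> carrier G \<times> carrier G. pcomp G g h = Some l}"
    have fS: "finite ?S" 
      by (rule finite_subset[of _ "carrier G \<times> carrier G"]) (auto simp: finite_arrows)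
    have "finsum K (\<lambda>(a,b). ubasis K G g a \<otimes>\<^bsub>K\<^esub> ubasis K G h b) ?S
      = finsum K (\<lambda>p. if (g,h) = p then \<one>\<^bsub>K\<^esub> else \<zero>\<^bsub>K\<^esub>) ?S" 
      using assms by (intro add.finprod_cong') (auto simp: ubasis_def split: if_splits)
    also have "\<dots> = (if (g,h) \<in> ?S then \<one>\<^bsub>K\<^esub> else \<zero>\<^bsub>K\<^esub>)"
    proof (cases "(g,h) \<in> ?S")
      case True
      then show ?thesis using add.finprod_singleton[OF True fS, of "\<lambda>_. \<one>\<^bsub>K\<^esub>"] by simp
    next
      case False
      then have "finsum K (\<lambda>p. if (g,h) = p then \<one>\<^bsub>K\<^esub> else \<zero>\<^bsub>K\<^esub>) ?S = finsum K (\<lambda>p. \<zero>\<^bsub>K\<^esub>) ?S"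
        by (intro add.finprod_cong') auto
      then show ?thesis using False by (simp only: add.finprod_one if_False)
    qed
    finally show "(ubasis K G g \<otimes>\<^bsub>groupoid_algebra K G\<^esub> ubasis K G h) l =
    (case pcomp G g h of Some k \<Rightarrow> ubasis K G k | None \<Rightarrow> \<zero>\<^bsub>groupoid_algebra K G\<^esub>) l"
      using assms by (auto simp: groupoid_algebra_def ubasis_def split: option.splits)
  qed
qed

definition comult ::
    "('k, 'm) ring_scheme \<Rightarrow> 'g pgroupoid \<Rightarrow> ('g \<Rightarrow> 'k) \<Rightarrow> 'g \<times> 'g \<Rightarrow> 'k" where
  "comult K G x = (\<lambda>(p, q)\<in>carrier G \<times> carrier G.
     \<Oplus>\<^bsub>K\<^esub>g\<in>carrier G. x g \<otimes>\<^bsub>K\<^esub> (ubasis K G g p \<otimes>\<^bsub>K\<^esub> ubasis K G g q))"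

definition counit :: "('k, 'm) ring_scheme \<Rightarrow> 'g pgroupoid \<Rightarrow> ('g \<Rightarrow> 'k) \<Rightarrow> 'k" where
  "counit K G x = (\<Oplus>\<^bsub>K\<^esub>g\<in>carrier G. x g)"

text \<open>\<open>\<epsilon>\<^sub>t(x) = \<epsilon>(1\<^sub>1 x) 1\<^sub>2\<close>, with the Sweedler sum read off from the coordinates of
  \<open>\<Delta>(1)\<close>.\<close>

definition counit_t ::
    "('k, 'm) ring_scheme \<Rightarrow> 'g pgroupoid \<Rightarrow> ('g \<Rightarrow> 'k) \<Rightarrow> 'g \<Rightarrow> 'k" where
  "counit_t K G x = (\<lambda>l\<in>carrier G. finsum K (\<lambda>(p, q).
     comult K G \<one>\<^bsub>groupoid_algebra K G\<^esub> (p, q)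
       \<otimes>\<^bsub>K\<^esub> counit K G (ubasis K G p \<otimes>\<^bsub>groupoid_algebra K G\<^esub> x) \<otimes>\<^bsub>K\<^esub> ubasis K G q l)
     (carrier G \<times> carrier G))"

text \<open>Elements of \<open>KG\<^sup>*\<close> are functionals on \<open>KG\<close>; the convolution product is given by its
  values on the basis \<open>u\<^sub>\<sigma>\<close> and extended linearly.\<close>

definition rho ::
    "('k, 'm) ring_scheme \<Rightarrow> 'g pgroupoid \<Rightarrow> 'g \<Rightarrow> ('g \<Rightarrow> 'k) \<Rightarrow> 'k" where
  "rho K G h = (\<lambda>x\<in>carrier (groupoid_algebra K G). x h)"

definition conv ::
    "('k, 'm) ring_scheme \<Rightarrow> 'g pgroupoid \<Rightarrow> (('g \<Rightarrow> 'k) \<Rightarrow> 'k) \<Rightarrow> (('g \<Rightarrow> 'k) \<Rightarrow> 'k)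
      \<Rightarrow> ('g \<Rightarrow> 'k) \<Rightarrow> 'k" where
  "conv K G f f' = (\<lambda>x\<in>carrier (groupoid_algebra K G).
     \<Oplus>\<^bsub>K\<^esub>g\<in>carrier G. x g \<otimes>\<^bsub>K\<^esub> (f (ubasis K G g) \<otimes>\<^bsub>K\<^esub> f' (ubasis K G g)))"


section \<open>Weak module algebras\<close>

text \<open>The library locale \<open>algebra\<close> is restricted to commutative algebras.\<close>

locale unital_algebra = module K B + ring B for K and B (structure) +
  assumes smult_mult_left:
      "\<lbrakk>c \<in> carrier K; a \<in> carrier B; b \<in> carrier B\<rbrakk> \<Longrightarrow>
        (c \<odot>\<^bsub>B\<^esub> a) \<otimes>\<^bsub>B\<^esub> b = c \<odot>\<^bsub>B\<^esub> (a \<otimes>\<^bsub>B\<^esub> b)"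
    and smult_mult_right:
      "\<lbrakk>c \<in> carrier K; a \<in> carrier B; b \<in> carrier B\<rbrakk> \<Longrightarrow>
        a \<otimes>\<^bsub>B\<^esub> (c \<odot>\<^bsub>B\<^esub> b) = c \<odot>\<^bsub>B\<^esub> (a \<otimes>\<^bsub>B\<^esub> b)"

locale weak_module_algebra = unital_algebra K B
  for K :: "('k, 'm) ring_scheme" and G :: "'g pgroupoid"
    and B :: "('k, 'b, 'n) module_scheme" and act :: "('g \<Rightarrow> 'k) \<Rightarrow> 'b \<Rightarrow> 'b" +
  assumes act_closed:
      "\<lbrakk>x \<in> carrier (groupoid_algebra K G); a \<in> carrier B\<rbrakk> \<Longrightarrow> act x a \<in> carrier B"
    and act_add_left:
      "\<lbrakk>x \<in> carrier (groupoid_algebra K G); y \<in> carrier (groupoid_algebra K G); a \<in> carrier B\<rbrakk> \<Longrightarrow>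
        act (x \<oplus>\<^bsub>groupoid_algebra K G\<^esub> y) a = act x a \<oplus>\<^bsub>B\<^esub> act y a"
    and act_add_right:
      "\<lbrakk>x \<in> carrier (groupoid_algebra K G); a \<in> carrier B; b \<in> carrier B\<rbrakk> \<Longrightarrow>
        act x (a \<oplus>\<^bsub>B\<^esub> b) = act x a \<oplus>\<^bsub>B\<^esub> act x b"
    and act_smult_left:
      "\<lbrakk>c \<in> carrier K; x \<in> carrier (groupoid_algebra K G); a \<in> carrier B\<rbrakk> \<Longrightarrow>
        act (c \<odot>\<^bsub>groupoid_algebra K G\<^esub> x) a = c \<odot>\<^bsub>B\<^esub> act x a"
    and act_smult_right:
      "\<lbrakk>c \<in> carrier K; x \<in> carrier (groupoid_algebra K G); a \<in> carrier B\<rbrakk> \<Longrightarrow>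
        act x (c \<odot>\<^bsub>B\<^esub> a) = c \<odot>\<^bsub>B\<^esub> act x a"
    and act_mult:
      "\<lbrakk>x \<in> carrier (groupoid_algebra K G); y \<in> carrier (groupoid_algebra K G); a \<in> carrier B\<rbrakk> \<Longrightarrow>
        act (x \<otimes>\<^bsub>groupoid_algebra K G\<^esub> y) a = act x (act y a)"
    and act_one: "a \<in> carrier B \<Longrightarrow> act \<one>\<^bsub>groupoid_algebra K G\<^esub> a = a"
    and act_on_mult:
      "\<lbrakk>x \<in> carrier (groupoid_algebra K G); a \<in> carrier B; b \<in> carrier B\<rbrakk> \<Longrightarrow>
        act x (a \<otimes>\<^bsub>B\<^esub> b) = finsum B (\<lambda>(p, q).
          comult K G x (p, q) \<odot>\<^bsub>B\<^esub> (act (ubasis K G p) a \<otimes>\<^bsub>B\<^esub> act (ubasis K G q) b))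
          (carrier G \<times> carrier G)"
    and act_on_one:
      "x \<in> carrier (groupoid_algebra K G) \<Longrightarrow> act x \<one>\<^bsub>B\<^esub> = act (counit_t K G x) \<one>\<^bsub>B\<^esub>"


section \<open>Smash products\<close>

text \<open>\<open>B \<otimes> KG\<close> is realised by coordinates in \<open>B\<close>: the family \<open>y\<close> stands for
  \<open>\<Sum>\<^sub>g y(g) \<sharp> u\<^sub>g\<close>. Likewise \<open>F\<close> in \<open>B \<otimes> KG \<otimes> KG\<^sup>*\<close> stands for
  \<open>\<Sum>\<^sub>g\<^sub>,\<^sub>h F(g,h) \<sharp> u\<^sub>g \<sharp> \<rho>\<^sub>h\<close>. The functions \<open>tens\<close> and \<open>tens_dual\<close> give the pure
  tensors \<open>b \<sharp> x\<close> (\<open>b \<in> B\<close>, \<open>x \<in> KG\<close>) and \<open>y \<sharp> f\<close> (\<open>y \<in> B \<sharp> KG\<close>,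
  \<open>f \<in> KG\<^sup>*\<close>).\<close>

definition tens ::
    "'g pgroupoid \<Rightarrow> ('k, 'b, 'n) module_scheme \<Rightarrow> 'b \<Rightarrow> ('g \<Rightarrow> 'k) \<Rightarrow> 'g \<Rightarrow> 'b" where
  "tens G B b x = (\<lambda>l\<in>carrier G. x l \<odot>\<^bsub>B\<^esub> b)"

definition tens_dual ::
    "('k, 'm) ring_scheme \<Rightarrow> 'g pgroupoid \<Rightarrow> ('k, 'b, 'n) module_scheme \<Rightarrow>
      ('g \<Rightarrow> 'b) \<Rightarrow> (('g \<Rightarrow> 'k) \<Rightarrow> 'k) \<Rightarrow> 'g \<times> 'g \<Rightarrow> 'b" where
  "tens_dual K G B y f = (\<lambda>(l, m)\<in>carrier G \<times> carrier G. f (ubasis K G m) \<odot>\<^bsub>B\<^esub> y l)"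

text \<open>The smash products have no unit in general, so the unit field of the record, which
  nothing below refers to, is left undefined.\<close>

definition smash ::
    "('k, 'm) ring_scheme \<Rightarrow> 'g pgroupoid \<Rightarrow> ('k, 'b, 'n) module_scheme \<Rightarrow>
      (('g \<Rightarrow> 'k) \<Rightarrow> 'b \<Rightarrow> 'b) \<Rightarrow> ('k, 'g \<Rightarrow> 'b) module" where
  "smash K G B act =
    \<lparr>carrier = carrier G \<rightarrow>\<^sub>E carrier B,
     monoid.mult = (\<lambda>y y'. \<lambda>l\<in>carrier G.
       \<Oplus>\<^bsub>B\<^esub>g\<in>carrier G. \<Oplus>\<^bsub>B\<^esub>h\<in>carrier G.
         tens G B (y g \<otimes>\<^bsub>B\<^esub> act (ubasis K G g) (y' h))
           (ubasis K G g \<otimes>\<^bsub>groupoid_algebra K G\<^esub> ubasis K G h) l),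
     one = undefined,
     zero = (\<lambda>l\<in>carrier G. \<zero>\<^bsub>B\<^esub>),
     add = (\<lambda>y y'. \<lambda>l\<in>carrier G. y l \<oplus>\<^bsub>B\<^esub> y' l),
     smult = (\<lambda>c y. \<lambda>l\<in>carrier G. c \<odot>\<^bsub>B\<^esub> y l)\<rparr>"

text \<open>\<open>f \<rightharpoonup> (b \<sharp> u\<^sub>l) = b \<sharp> f(u\<^sub>l) u\<^sub>l\<close>.\<close>

definition dual_act ::
    "('k, 'm) ring_scheme \<Rightarrow> 'g pgroupoid \<Rightarrow> ('k, 'b, 'n) module_scheme \<Rightarrow>
      (('g \<Rightarrow> 'k) \<Rightarrow> 'k) \<Rightarrow> ('g \<Rightarrow> 'b) \<Rightarrow> 'g \<Rightarrow> 'b" where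
  "dual_act K G B f y = (\<lambda>l\<in>carrier G. f (ubasis K G l) \<odot>\<^bsub>B\<^esub> y l)"

definition double_smash ::
    "('k, 'm) ring_scheme \<Rightarrow> 'g pgroupoid \<Rightarrow> ('k, 'b, 'n) module_scheme \<Rightarrow>
      (('g \<Rightarrow> 'k) \<Rightarrow> 'b \<Rightarrow> 'b) \<Rightarrow> ('k, 'g \<times> 'g \<Rightarrow> 'b) module" where
  "double_smash K G B act =
    \<lparr>carrier = carrier G \<times> carrier G \<rightarrow>\<^sub>E carrier B,
     monoid.mult = (\<lambda>F F'. \<lambda>i\<in>carrier G \<times> carrier G.
       \<Oplus>\<^bsub>B\<^esub>g\<in>carrier G. \<Oplus>\<^bsub>B\<^esub>h\<in>carrier G.
       \<Oplus>\<^bsub>B\<^esub>g'\<in>carrier G. \<Oplus>\<^bsub>B\<^esub>h'\<in>carrier G.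
         \<Oplus>\<^bsub>B\<^esub>k\<in>{k \<in> carrier G. tgt G k = tgt G h}.
           tens_dual K G B
             (tens G B (F (g, h)) (ubasis K G g) \<otimes>\<^bsub>smash K G B act\<^esub>
               dual_act K G B (rho K G (the (pcomp G h (ginv G k))))
                 (tens G B (F' (g', h')) (ubasis K G g')))
             (conv K G (rho K G k) (rho K G h')) i),
     one = undefined,
     zero = (\<lambda>i\<in>carrier G \<times> carrier G. \<zero>\<^bsub>B\<^esub>),
     add = (\<lambda>F F'. \<lambda>i\<in>carrier G \<times> carrier G. F i \<oplus>\<^bsub>B\<^esub> F' i),
     smult = (\<lambda>c F. \<lambda>i\<in>carrier G \<times> carrier G. c \<odot>\<^bsub>B\<^esub> F i)\<rparr>"


text \<open>On pure tensors in the basis vectors, the two products are given by the defining formulas.\<close>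

context weak_module_algebra begin

lemma finsum_delta:
  assumes "finite A" "i \<in> A" "c \<in> carrier B" "\<And>j. j \<in> A \<Longrightarrow> f j = (if j = i then c else \<zero>\<^bsub>B\<^esub>)"
  shows "finsum B f A = c"
proof -
  have "finsum B f A = finsum B (\<lambda>j. if i = j then c else \<zero>\<^bsub>B\<^esub>) A"
    using assms by (intro M.add.finprod_cong') auto
  also have "\<dots> = c" using M.add.finprod_singleton[OF assms(2,1), of "\<lambda>_. c"] assms(3) by simp
  finally show ?thesis .
qed

lemma ubasis_closed: "ubasis K G g \<in> carrier (groupoid_algebra K G)"
  by (auto simp: ubasis_def groupoid_algebra_def)

lemma act_zero: assumes "x \<in> carrier (groupoid_algebra K G)" shows "act x \<zero>\<^bsub>B\<^esub> = \<zero>\<^bsub>B\<^esub>"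
  using act_smult_right[OF R.zero_closed assms, of "\<zero>\<^bsub>B\<^esub>"] act_closed[OF assms, of "\<zero>\<^bsub>B\<^esub>"] by simp

lemma smash_mult:
  assumes G: "finite_groupoid G" and g: "g \<in> carrier G" and h: "h \<in> carrier G"
    and a: "a \<in> carrier B" and b: "b \<in> carrier B"
  shows "tens G B a (ubasis K G g) \<otimes>\<^bsub>smash K G B act\<^esub> tens G B b (ubasis K G h)
   = tens G B (a \<otimes>\<^bsub>B\<^esub> act (ubasis K G g) b) (ubasis K G g \<otimes>\<^bsub>groupoid_algebra K G\<^esub> ubasis K G h)"
proof -
  interpret finite_groupoid G by fact
  let ?u = "ubasis K G" 
  have c: "(?u p \<otimes>\<^bsub>groupoid_algebra K G\<^esub> ?u q) l \<in> carrier K" if "p \<in> carrier G" "q \<in> carrier G" "l \<in> carrier G" for p q l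
    using that ubasis_mult[OF R.ring_axioms G that(1,2)] 
    by (auto simp: ubasis_def groupoid_algebra_def split: option.splits)
  have e: "tens G B a (?u g) p = (if p = g then a else \<zero>\<^bsub>B\<^esub>)" if "p \<in> carrier G" "a \<in> carrier B" for p g a
    using that by (simp add: tens_def ubasis_def)
  show ?thesis
  proof (rule ext)
    fix l
    show "(tens G B a (?u g) \<otimes>\<^bsub>smash K G B act\<^esub> tens G B b (?u h)) l = 
      tens G B (a \<otimes>\<^bsub>B\<^esub> act (ubasis K G g) b) (?u g \<otimes>\<^bsub>groupoid_algebra K G\<^esub> ?u h) l"
    proof (cases "l \<in> carrier G")
      case False then show ?thesis by (simp add: smash_def tens_def)
    next
      case l: True
      let ?r = "tens G B (a \<otimes>\<^bsub>B\<^esub> act (?u g) b) (?u g \<otimes>\<^bsub>groupoid_algebra K G\<^esub> ?u h) l"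
      let ?t = "\<lambda>p q. tens G B (tens G B a (?u g) p \<otimes>\<^bsub>B\<^esub> act (?u p) (tens G B b (?u h) q)) (?u p \<otimes>\<^bsub>groupoid_algebra K G\<^esub> ?u q) l"
      have r: "?r \<in> carrier B" using l c g h a b act_closed ubasis_closed by (simp add: tens_def)
      have t: "?t p q = (if p = g \<and> q = h then ?r else \<zero>\<^bsub>B\<^esub>)" if "p \<in> carrier G" "q \<in> carrier G" for p q
        using that a b l c[OF that l] act_zero[OF ubasis_closed] act_closed ubasis_closed e by (cases "p = g"; cases "q = h") (simp_all add: tens_def)
      have s: "finsum B (?t p) (carrier G) = (if p = g then ?r else \<zero>\<^bsub>B\<^esub>)" if p: "p \<in> carrier G" for p
        by (rule finsum_delta[where i = h]) (use finite_arrows h p r t in auto)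
      have "finsum B (\<lambda>p. finsum B (?t p) (carrier G)) (carrier G) = ?r"
        by (rule finsum_delta[where i = g]) (use finite_arrows g r s in auto)
      then show ?thesis using l by (simp add: smash_def)
    qed
  qed
qed

lemma ubasis_prod_coord: "\<lbrakk>finite_groupoid G; p \<in> carrier G; q \<in> carrier G; l \<in> carrier G\<rbrakk> \<Longrightarrow>
  (ubasis K G p \<otimes>\<^bsub>groupoid_algebra K G\<^esub> ubasis K G q) l \<in> carrier K"
  unfolding ubasis_mult[OF R.ring_axioms]
  by (auto simp: ubasis_def groupoid_algebra_def split: option.splits)

lemma rho_coord: "\<lbrakk>z \<in> carrier G; l \<in> carrier G\<rbrakk> \<Longrightarrow>
    rho K G z (ubasis K G l) = (if z = l then \<one>\<^bsub>K\<^esub> else \<zero>\<^bsub>K\<^esub>)"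
  using ubasis_closed[of l] by (simp add: rho_def) (simp add: ubasis_def)

lemma conv_coord:
  assumes "finite_groupoid G" "k \<in> carrier G" "h \<in> carrier G" "l \<in> carrier G"
  shows "conv K G (rho K G k) (rho K G h) (ubasis K G l)
    = rho K G k (ubasis K G l) \<otimes>\<^bsub>K\<^esub> rho K G h (ubasis K G l)" (is "_ = ?c")
proof -
  interpret finite_groupoid G by fact
  have c: "?c \<in> carrier K" using assms by (simp add: rho_coord)
  have u: "ubasis K G l j = (if l = j then \<one>\<^bsub>K\<^esub> else \<zero>\<^bsub>K\<^esub>)" if "j \<in> carrier G" for j
    using that by (auto simp: ubasis_def)
  let ?f = "\<lambda>g. ubasis K G l g \<otimes>\<^bsub>K\<^esub> (rho K G k (ubasis K G g) \<otimes>\<^bsub>K\<^esub> rho K G h (ubasis K G g))"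
  have "finsum K ?f (carrier G) = finsum K (\<lambda>j. if l = j then ?c else \<zero>\<^bsub>K\<^esub>) (carrier G)"
    using assms c by (intro R.add.finprod_cong') (auto simp: rho_coord u)
  also have "\<dots> = ?c"
    using R.add.finprod_singleton[OF assms(4) finite_arrows, of "\<lambda>_. ?c"] c by simp
  finally show ?thesis using ubasis_closed[of l] by (simp add: conv_def)
qed

lemma double_smash_mult:
  assumes G: "finite_groupoid G" and g: "g \<in> carrier G" and h: "h \<in> carrier G"
    and g': "g' \<in> carrier G" and h': "h' \<in> carrier G"
    and a: "a \<in> carrier B" and b: "b \<in> carrier B"
    and i: "i \<in> carrier G \<times> carrier G"
  shows "(tens_dual K G B (tens G B a (ubasis K G g)) (rho K G h) \<otimes>\<^bsub>double_smash K G B act\<^esub>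
      tens_dual K G B (tens G B b (ubasis K G g')) (rho K G h')) i
    = (\<Oplus>\<^bsub>B\<^esub>k\<in>{k \<in> carrier G. tgt G k = tgt G h}.
        tens_dual K G B
          (tens G B a (ubasis K G g) \<otimes>\<^bsub>smash K G B act\<^esub>
            dual_act K G B (rho K G (the (pcomp G h (ginv G k)))) (tens G B b (ubasis K G g')))
          (conv K G (rho K G k) (rho K G h')) i)"
proof -
  interpret finite_groupoid G by fact
  let ?u = "ubasis K G"
  let ?F = "\<lambda>a g h. tens_dual K G B (tens G B a (?u g)) (rho K G h)"
  let ?z = "\<lambda>q k. the (pcomp G q (ginv G k))"
  let ?X = "\<lambda>a p q b p' q' k. tens_dual K G B (tens G B a (?u p) \<otimes>\<^bsub>smash K G B act\<^esub>
       dual_act K G B (rho K G (?z q k)) (tens G B b (?u p'))) (conv K G (rho K G k) (rho K G q')) i"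
  let ?Y = "\<lambda>a p q b p' q'. finsum B (?X a p q b p' q') {k \<in> carrier G. tgt G k = tgt G q}"
  have F: "?F a g h (p, q) = (if p = g \<and> q = h then a else \<zero>\<^bsub>B\<^esub>)"
    if "p \<in> carrier G" "q \<in> carrier G" "h \<in> carrier G" "a \<in> carrier B" for p q g h a
    using that by (simp add: tens_dual_def tens_def rho_coord) (auto simp: ubasis_def)
  have zc: "?z q k \<in> carrier G" if "q \<in> carrier G" "k \<in> carrier G" "tgt G k = tgt G q" for q k
  proof -
    have "src G (ginv G k) = tgt G k"
      using pcomp_defined_iff[OF that(2) ginv_closed[OF that(2)]] ginv_pcomp_defined[OF that(2)]
      by simp
    then have "pcomp G q (ginv G k) \<noteq> None"
      using that(3) pcomp_defined_iff[OF that(1) ginv_closed[OF that(2)]] by simp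
    then obtain z where "pcomp G q (ginv G k) = Some z" by blast
    then show ?thesis using pcomp_closed[OF that(1) ginv_closed[OF that(2)]] by simp
  qed
  have D: "dual_act K G B (rho K G z) (tens G B b (?u p')) = tens G B (rho K G z (?u p') \<odot>\<^bsub>B\<^esub> b) (?u p')"
    if "z \<in> carrier G" "p' \<in> carrier G" "b \<in> carrier B" for z b p'
  proof (rule ext)
    fix l
    have u: "?u p' l = (if l = p' then \<one>\<^bsub>K\<^esub> else \<zero>\<^bsub>K\<^esub>)" if "l \<in> carrier G"
      using that by (simp add: ubasis_def)
    show "dual_act K G B (rho K G z) (tens G B b (?u p')) l
        = tens G B (rho K G z (?u p') \<odot>\<^bsub>B\<^esub> b) (?u p') l"
      using that by (simp add: dual_act_def tens_def rho_coord u)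
  qed
  have X: "?X a p q b p' q' k = (rho K G k (?u (snd i)) \<otimes>\<^bsub>K\<^esub> rho K G q' (?u (snd i))) \<odot>\<^bsub>B\<^esub>
      ((?u p \<otimes>\<^bsub>groupoid_algebra K G\<^esub> ?u p') (fst i) \<odot>\<^bsub>B\<^esub> (a \<otimes>\<^bsub>B\<^esub> act (?u p) (rho K G (?z q k) (?u p') \<odot>\<^bsub>B\<^esub> b)))"
    if "p \<in> carrier G" "q \<in> carrier G" "p' \<in> carrier G" "q' \<in> carrier G" "k \<in> carrier G"
      "tgt G k = tgt G q" "a \<in> carrier B" "b \<in> carrier B" for a p q b p' q' k
  proof -
    have bc: "rho K G (?z q k) (?u p') \<odot>\<^bsub>B\<^esub> b \<in> carrier B"
      using rho_coord[OF zc[OF that(2,5,6)] that(3)] that by simp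
    show ?thesis
      unfolding D[OF zc[OF that(2,5,6)] that(3,8)] smash_mult[OF G that(1,3,7) bc]
      using i conv_coord[OF G that(5,4)] by (auto simp: tens_dual_def tens_def)
  qed
  have Xc: "?X a p q b p' q' k \<in> carrier B" and X0: "?X \<zero>\<^bsub>B\<^esub> p q b p' q' k = \<zero>\<^bsub>B\<^esub>"
      "?X a p q \<zero>\<^bsub>B\<^esub> p' q' k = \<zero>\<^bsub>B\<^esub>"
    if "p \<in> carrier G" "q \<in> carrier G" "p' \<in> carrier G" "q' \<in> carrier G" "k \<in> carrier G"
      "tgt G k = tgt G q" "a \<in> carrier B" "b \<in> carrier B" for a p q b p' q' k
  proof -
    have r: "rho K G (?z q k) (?u p') \<in> carrier K" using rho_coord[OF zc[OF that(2,5,6)] that(3)] that by simp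
    have c: "(?u p \<otimes>\<^bsub>groupoid_algebra K G\<^esub> ?u p') (fst i) \<in> carrier K"
      using ubasis_prod_coord[OF G] that i by auto
    have k: "rho K G k (?u (snd i)) \<otimes>\<^bsub>K\<^esub> rho K G q' (?u (snd i)) \<in> carrier K"
      using i that by (auto simp: rho_coord)
    show "?X a p q b p' q' k \<in> carrier B"
      unfolding X[OF that] using k c r act_closed ubasis_closed that by simp
    show "?X \<zero>\<^bsub>B\<^esub> p q b p' q' k = \<zero>\<^bsub>B\<^esub>"
      unfolding X[OF that(1-6) M.zero_closed that(8)] using k c r act_closed ubasis_closed that by simp
    show "?X a p q \<zero>\<^bsub>B\<^esub> p' q' k = \<zero>\<^bsub>B\<^esub>"
      unfolding X[OF that(1-7) M.zero_closed] using k c r act_closed ubasis_closed that act_zero by simp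
  qed
  have Y: "?Y (?F a g h (p,q)) p q (?F b g' h' (p',q')) p' q'
     = (if p = g \<and> q = h \<and> p' = g' \<and> q' = h' then ?Y a g h b g' h' else \<zero>\<^bsub>B\<^esub>)"
    if "p \<in> carrier G" "q \<in> carrier G" "p' \<in> carrier G" "q' \<in> carrier G" for p q p' q'
  proof (cases "p = g \<and> q = h \<and> p' = g' \<and> q' = h'")
    case True then show ?thesis using F that a b by simp
  next
    case False
    have "?Y (?F a g h (p,q)) p q (?F b g' h' (p',q')) p' q' = finsum B (\<lambda>_. \<zero>\<^bsub>B\<^esub>) {k \<in> carrier G. tgt G k = tgt G q}"
      using False that a b X0 by (intro M.add.finprod_cong') (auto simp: F h h')
    then show ?thesis using False by (simp only: M.add.finprod_one if_False)
  qed
  have Yc: "?Y a g h b g' h' \<in> carrier B" using Xc g h g' h' a b by (intro M.add.finprod_closed) auto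
  let ?W = "\<lambda>p q p' q'. ?Y (?F a g h (p,q)) p q (?F b g' h' (p',q')) p' q'"
  have 1: "finsum B (?W p q p') (carrier G) = (if p = g \<and> q = h \<and> p' = g' then ?Y a g h b g' h' else \<zero>\<^bsub>B\<^esub>)"
    if "p \<in> carrier G" "q \<in> carrier G" "p' \<in> carrier G" for p q p'
    by (rule finsum_delta[where i = h']) (use finite_arrows h' Yc Y[OF that] in auto)
  have 2: "finsum B (\<lambda>p'. finsum B (?W p q p') (carrier G)) (carrier G) = (if p = g \<and> q = h then ?Y a g h b g' h' else \<zero>\<^bsub>B\<^esub>)"
    if "p \<in> carrier G" "q \<in> carrier G" for p q
    by (rule finsum_delta[where i = g']) (use finite_arrows g' Yc 1[OF that] in auto)
  have 3: "finsum B (\<lambda>q. finsum B (\<lambda>p'. finsum B (?W p q p') (carrier G)) (carrier G)) (carrier G) = (if p = g then ?Y a g h b g' h' else \<zero>\<^bsub>B\<^esub>)"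
    if "p \<in> carrier G" for p
    by (rule finsum_delta[where i = h]) (use finite_arrows h Yc 2[OF that] in auto)
  have "finsum B (\<lambda>p. finsum B (\<lambda>q. finsum B (\<lambda>p'. finsum B (?W p q p') (carrier G)) (carrier G)) (carrier G)) (carrier G) = ?Y a g h b g' h'"
    by (rule finsum_delta[where i = g]) (use finite_arrows g Yc 3 in auto)
  then show ?thesis using i by (simp add: double_smash_def)
qed

end


section \<open>Subalgebras, ideals and direct sums in algebras without unit\<close>

text \<open>The library's \<open>subalgebra\<close>, \<open>subring\<close> and \<open>ideal\<close> all presuppose a unital ambient ring.\<close>

definition is_subalgebra ::
    "('k, 'm) ring_scheme \<Rightarrow> ('k, 'a, 'n) module_scheme \<Rightarrow> 'a set \<Rightarrow> bool" where
  "is_subalgebra K A S \<longleftrightarrow> submodule S K A \<and> (\<forall>x\<in>S. \<forall>y\<in>S. x \<otimes>\<^bsub>A\<^esub> y \<in> S)"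

text \<open>The zero algebra has a unit in this sense. The unit of \<open>S\<close> need not be a unit of an
  algebra containing \<open>S\<close>.\<close>

definition has_unit :: "('k, 'a, 'n) module_scheme \<Rightarrow> 'a set \<Rightarrow> bool" where
  "has_unit A S \<longleftrightarrow> (\<exists>e\<in>S. \<forall>x\<in>S. e \<otimes>\<^bsub>A\<^esub> x = x \<and> x \<otimes>\<^bsub>A\<^esub> e = x)"

definition is_ideal ::
    "('k, 'm) ring_scheme \<Rightarrow> ('k, 'a, 'n) module_scheme \<Rightarrow> 'a set \<Rightarrow> bool" where
  "is_ideal K A D \<longleftrightarrow> submodule D K A \<and>
     (\<forall>a\<in>carrier A. \<forall>d\<in>D. a \<otimes>\<^bsub>A\<^esub> d \<in> D \<and> d \<otimes>\<^bsub>A\<^esub> a \<in> D)"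

definition direct_sum_of ::
    "('k, 'a, 'n) module_scheme \<Rightarrow> 'a set \<Rightarrow> 'a set \<Rightarrow> 'a set \<Rightarrow> bool" where
  "direct_sum_of A S U V \<longleftrightarrow> U \<subseteq> S \<and> V \<subseteq> S \<and>
     (\<forall>u\<in>U. \<forall>v\<in>V. u \<oplus>\<^bsub>A\<^esub> v \<in> S) \<and>
     (\<forall>s\<in>S. \<exists>!p. p \<in> U \<times> V \<and> s = fst p \<oplus>\<^bsub>A\<^esub> snd p)"

text \<open>A direct sum as algebras has componentwise multiplication, which for an internal
  direct sum of subalgebras means that mixed products vanish.\<close>

definition algebra_direct_sum_of ::
    "('k, 'm) ring_scheme \<Rightarrow> ('k, 'a, 'n) module_scheme \<Rightarrow> 'a set \<Rightarrow> 'a set \<Rightarrow> 'a set \<Rightarrow> bool" where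
  "algebra_direct_sum_of K A S U V \<longleftrightarrow>
     is_subalgebra K A U \<and> is_subalgebra K A V \<and> direct_sum_of A S U V \<and>
     (\<forall>u\<in>U. \<forall>v\<in>V. u \<otimes>\<^bsub>A\<^esub> v = \<zero>\<^bsub>A\<^esub> \<and> v \<otimes>\<^bsub>A\<^esub> u = \<zero>\<^bsub>A\<^esub>)"

end

theory Submission
  imports Defs
begin

text \<open>Reading \<open>a \<sharp> u\<^sub>g \<sharp> \<rho>\<^sub>h\<close> as a matrix entry in row \<open>gh\<close> and column \<open>h\<close>, the double
  smash product multiplies
  \<open>(a \<sharp> u\<^sub>g \<sharp> \<rho>\<^sub>h)(b \<sharp> u\<^sub>g\<^sub>' \<sharp> \<rho>\<^sub>m) = a(g.b) \<sharp> u\<^sub>g\<^sub>g\<^sub>' \<sharp> \<rho>\<^sub>m\<close> if \<open>h = g'm\<close> and \<open>gg'\<close> exists,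
  and to zero otherwise. The basis tensors for which \<open>gh\<close> does not exist annihilate everything
  from both sides; they span \<open>D\<close>, and the remaining ones span \<open>S\<close>. The identities \<open>e\<close> of \<open>G\<close>
  act on \<open>B\<close> as orthogonal projections onto ideals \<open>e.B\<close> with unit \<open>e.1\<close>, and \<open>g\<close> acts as an
  isomorphism from \<open>t(g).B\<close> to \<open>s(g).B\<close>. Restricting the coefficient of \<open>u\<^sub>g\<close> to \<open>s(g).B\<close>
  gives \<open>S'\<close>, with unit \<open>\<Sum>\<^sub>h s(h).1 \<sharp> u\<^sub>s\<^sub>(\<^sub>h\<^sub>) \<sharp> \<rho>\<^sub>h\<close>; restricting it to the kernel of
  \<open>s(g)\<close> gives the complement \<open>T\<close>, which annihilates \<open>S\<close>.\<close>

section \<open>Sources, targets and division in a groupoid\<close>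

context groupoid
begin

text \<open>By associativity the source of \<open>g\<close> composes with \<open>k\<close> from the
  left and the target of \<open>h\<close> from the right; composability with an identity pins down
  the source and target of \<open>k\<close>.\<close>

lemma src_tgt_pcomp:
  assumes g: "g \<in> carrier G" and h: "h \<in> carrier G" and k: "pcomp G g h = Some k"
  shows "src G k = src G g" "tgt G k = tgt G h"
proof -
  have kc: "k \<in> carrier G" using pcomp_closed[OF g h k] .
  have "pcomp G (src G g) k = Some k"
    using pcomp_assoc[OF src_tgt_Some(3)[OF g] g h] pcomp_tgt(2)[OF g] k by simp
  then have s: "tgt G (src G g) = src G k"
    using pcomp_defined_iff[OF src_tgt_Some(3)[OF g] kc] by simp
  have "tgt G (src G g) = src G g"
    using pcomp_defined_iff[OF src_tgt_Some(3)[OF g] g] pcomp_tgt(2)[OF g] by simp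
  with s show "src G k = src G g" by simp
  have "pcomp G k (tgt G h) = Some k"
    using pcomp_assoc[OF g h src_tgt_Some(4)[OF h]] pcomp_tgt(1)[OF h] k by simp
  then have t: "tgt G k = src G (tgt G h)"
    using pcomp_defined_iff[OF kc src_tgt_Some(4)[OF h]] by simp
  have "tgt G h = src G (tgt G h)"
    using pcomp_defined_iff[OF h src_tgt_Some(4)[OF h]] pcomp_tgt(1)[OF h] by simp
  with t show "tgt G k = tgt G h" by simp
qed

lemma tgt_eq_src_if_pcomp:
  assumes "g \<in> carrier G" "h \<in> carrier G" "pcomp G g h = Some k"
  shows "tgt G g = src G h"
  using pcomp_defined_iff[OF assms(1,2)] assms(3) by simp

lemma src_src: "g \<in> carrier G \<Longrightarrow> src G (src G g) = src G g"
  using src_tgt_pcomp(1)[OF _ ginv_closed src_tgt_Some(1)] by simp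

lemma tgt_src: "g \<in> carrier G \<Longrightarrow> tgt G (src G g) = src G g"
  using tgt_eq_src_if_pcomp[OF src_tgt_Some(3) _ pcomp_tgt(2)] by simp

lemma src_ginv: "g \<in> carrier G \<Longrightarrow> src G (ginv G g) = tgt G g"
  using tgt_eq_src_if_pcomp[OF _ ginv_closed src_tgt_Some(1)] by simp

text \<open>Division by \<open>k\<close>. It turns the index of the dual comultiplication into the
  matrix condition; equality of targets ensures that the product under \<open>the\<close>
  exists.\<close>

lemma pcomp_eq_iff:
  assumes g: "g \<in> carrier G" and h: "h \<in> carrier G" and k: "k \<in> carrier G"
  shows "pcomp G g k = Some h \<longleftrightarrow> tgt G k = tgt G h \<and> the (pcomp G h (ginv G k)) = g"
proof
  assume "pcomp G g k = Some h"
  then show "tgt G k = tgt G h \<and> the (pcomp G h (ginv G k)) = g"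
    using pcomp_ginv_cancel[OF g k] src_tgt_pcomp(2)[OF g k] by simp
next
  assume *: "tgt G k = tgt G h \<and> the (pcomp G h (ginv G k)) = g"
  then have hk: "pcomp G h (ginv G k) = Some g"
    using pcomp_defined_iff[OF h ginv_closed[OF k]] src_ginv[OF k] by fastforce
  show "pcomp G g k = Some h"
    using pcomp_assoc[OF h ginv_closed[OF k] k] hk src_tgt_Some(2)[OF k] * pcomp_tgt(1)[OF h]
    by simp
qed

lemma identities_iff: "l \<in> identities G \<longleftrightarrow> l \<in> carrier G \<and> src G l = l"
  unfolding identities_def by (auto simp: src_src src_tgt_Some(3) image_iff intro: bexI[of _ l])

end

section \<open>Internal direct sums in a module\<close>

text \<open>Each \<open>x\<close> splits as \<open>p x\<close> plus \<open>x - p x\<close>, and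
  applying \<open>p\<close> to any splitting returns its first component, which gives uniqueness.
  Here \<open>p\<close> will be the action of an identity of \<open>G\<close>.\<close>

lemma (in module) direct_sum_of_ker_fixed:
  assumes closed: "\<And>x. x \<in> carrier M \<Longrightarrow> p x \<in> carrier M"
    and add: "\<And>x y. x \<in> carrier M \<Longrightarrow> y \<in> carrier M \<Longrightarrow> p (x \<oplus>\<^bsub>M\<^esub> y) = p x \<oplus>\<^bsub>M\<^esub> p y"
    and idem: "\<And>x. x \<in> carrier M \<Longrightarrow> p (p x) = p x"
  shows "direct_sum_of M (carrier M) {x \<in> carrier M. p x = x} {x \<in> carrier M. p x = \<zero>\<^bsub>M\<^esub>}"
  unfolding direct_sum_of_def
proof (intro conjI ballI)
  fix x assume x: "x \<in> carrier M"
  have diff: "p (x \<ominus>\<^bsub>M\<^esub> p x) = \<zero>\<^bsub>M\<^esub>"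
  proof -
    \<comment> \<open>In this form additivity and idempotence yield p x = p (x - p x) + p x, and
      \<open>p x\<close> cancels.\<close>
    have e: "x = (x \<ominus>\<^bsub>M\<^esub> p x) \<oplus>\<^bsub>M\<^esub> p x"
      using x closed by (simp add: M.minus_eq M.a_assoc M.l_neg)
    have "p x = p (x \<ominus>\<^bsub>M\<^esub> p x) \<oplus>\<^bsub>M\<^esub> p x"
      using add[of "x \<ominus>\<^bsub>M\<^esub> p x" "p x"] e x closed idem by simp
    then show ?thesis using x closed by simp
  qed
  show "\<exists>!q. q \<in> {x \<in> carrier M. p x = x} \<times> {x \<in> carrier M. p x = \<zero>\<^bsub>M\<^esub>} \<and>
      x = fst q \<oplus>\<^bsub>M\<^esub> snd q"
  proof (rule ex1I[of _ "(p x, x \<ominus>\<^bsub>M\<^esub> p x)"])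
    show "(p x, x \<ominus>\<^bsub>M\<^esub> p x) \<in> {x \<in> carrier M. p x = x} \<times> {x \<in> carrier M. p x = \<zero>\<^bsub>M\<^esub>} \<and>
      x = fst (p x, x \<ominus>\<^bsub>M\<^esub> p x) \<oplus>\<^bsub>M\<^esub> snd (p x, x \<ominus>\<^bsub>M\<^esub> p x)"
      using x closed idem diff by (simp add: M.minus_eq M.a_lcomm M.r_neg)
  next
    fix q
    assume q: "q \<in> {x \<in> carrier M. p x = x} \<times> {x \<in> carrier M. p x = \<zero>\<^bsub>M\<^esub>} \<and>
      x = fst q \<oplus>\<^bsub>M\<^esub> snd q"
    then have f: "fst q \<in> carrier M" "snd q \<in> carrier M" "p (fst q) = fst q" "p (snd q) = \<zero>\<^bsub>M\<^esub>"
      by auto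
    then have px: "p x = fst q" using add q by simp
    have "x \<ominus>\<^bsub>M\<^esub> p x = \<ominus>\<^bsub>M\<^esub> fst q \<oplus>\<^bsub>M\<^esub> (fst q \<oplus>\<^bsub>M\<^esub> snd q)"
      unfolding px using f q by (simp add: M.minus_eq M.a_comm)
    also have "\<dots> = snd q" using f by (simp add: M.a_assoc[symmetric] M.l_neg)
    finally show "q = (p x, x \<ominus>\<^bsub>M\<^esub> p x)" by (simp add: px prod_eq_iff)
  qed
qed auto

text \<open>Serves the positions at which one of the two summands is trivial.\<close>

lemma (in module) direct_sum_of_zero:
  assumes "W \<subseteq> carrier M" "\<zero>\<^bsub>M\<^esub> \<in> W"
  shows "direct_sum_of M W W {\<zero>\<^bsub>M\<^esub>}" "direct_sum_of M W {\<zero>\<^bsub>M\<^esub>} W"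
proof -
  have l: "\<exists>!p. p \<in> W \<times> {\<zero>\<^bsub>M\<^esub>} \<and> s = fst p \<oplus>\<^bsub>M\<^esub> snd p" if "s \<in> W" for s
    by (rule ex1I[of _ "(s, \<zero>\<^bsub>M\<^esub>)"]) (use that assms in auto)
  have r: "\<exists>!p. p \<in> {\<zero>\<^bsub>M\<^esub>} \<times> W \<and> s = fst p \<oplus>\<^bsub>M\<^esub> snd p" if "s \<in> W" for s
    by (rule ex1I[of _ "(\<zero>\<^bsub>M\<^esub>, s)"]) (use that assms in auto)
  show "direct_sum_of M W W {\<zero>\<^bsub>M\<^esub>}"
    unfolding direct_sum_of_def by (intro conjI ballI l) (use assms in auto)
  show "direct_sum_of M W {\<zero>\<^bsub>M\<^esub>} W"
    unfolding direct_sum_of_def by (intro conjI ballI r) (use assms in auto)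
qed

section \<open>The action of arrows on the module algebra\<close>

locale groupoid_weak_module_algebra =
  weak_module_algebra K G B act + finite_groupoid G
  for K :: "('k, 'm) ring_scheme" and G :: "'g pgroupoid"
    and B :: "('k, 'b, 'n) module_scheme" and act :: "('g \<Rightarrow> 'k) \<Rightarrow> 'b \<Rightarrow> 'b"
begin

lemma finite_groupoid: "finite_groupoid G" ..

abbreviation arrow_act :: "'g \<Rightarrow> 'b \<Rightarrow> 'b" (infixr \<open>\<rhd>\<close> 75) where
  "g \<rhd> a \<equiv> act (ubasis K G g) a"

abbreviation A :: "('k, 'g \<times> 'g \<Rightarrow> 'b) module" where
  "A \<equiv> double_smash K G B act"

abbreviation I :: "('g \<times> 'g) set" where
  "I \<equiv> carrier G \<times> carrier G"

lemma arrow_act_closed: "a \<in> carrier B \<Longrightarrow> g \<rhd> a \<in> carrier B"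
  using act_closed ubasis_closed by blast

lemma ubasis_apply:
  "l \<in> carrier G \<Longrightarrow> ubasis K G g l = (if l = g then \<one>\<^bsub>K\<^esub> else \<zero>\<^bsub>K\<^esub>)"
  by (simp add: ubasis_def)

lemma act_zero_left: "a \<in> carrier B \<Longrightarrow> act \<zero>\<^bsub>groupoid_algebra K G\<^esub> a = \<zero>\<^bsub>B\<^esub>"
proof -
  assume a: "a \<in> carrier B"
  \<comment> \<open>Zero is written as a multiple of a basis vector so that linearity applies. If
    \<open>undefined\<close> is not an arrow, \<open>ubasis\<close> is itself the zero
    vector.\<close>
  have z: "\<zero>\<^bsub>groupoid_algebra K G\<^esub> = \<zero>\<^bsub>K\<^esub> \<odot>\<^bsub>groupoid_algebra K G\<^esub> ubasis K G undefined"
    by (auto simp: groupoid_algebra_def ubasis_def fun_eq_iff)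
  show ?thesis
    unfolding z act_smult_left[OF R.zero_closed ubasis_closed a]
    using arrow_act_closed[OF a] by simp
qed

lemma arrow_act_comp:
  assumes "g \<in> carrier G" "h \<in> carrier G" "a \<in> carrier B"
  shows "g \<rhd> h \<rhd> a = (case pcomp G g h of Some k \<Rightarrow> k \<rhd> a | None \<Rightarrow> \<zero>\<^bsub>B\<^esub>)"
  using act_mult[OF ubasis_closed ubasis_closed assms(3), of g h]
    ubasis_mult[OF R.ring_axioms finite_groupoid assms(1,2)] act_zero_left[OF assms(3)]
  by (auto split: option.splits)

text \<open>Basis vectors are grouplike, so only diagonal coordinates survive.\<close>

lemma comult_eq:
  assumes x: "x \<in> carrier (groupoid_algebra K G)" and p: "p \<in> carrier G" "q \<in> carrier G"
  shows "comult K G x (p, q) = (if p = q then x p else \<zero>\<^bsub>K\<^esub>)"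
proof -
  let ?c = "if p = q then x p else \<zero>\<^bsub>K\<^esub>"
  have xc: "x g \<in> carrier K" if "g \<in> carrier G" for g
    using x that by (auto simp: groupoid_algebra_def)
  have "(\<Oplus>\<^bsub>K\<^esub>g\<in>carrier G. x g \<otimes>\<^bsub>K\<^esub> (ubasis K G g p \<otimes>\<^bsub>K\<^esub> ubasis K G g q))
      = (\<Oplus>\<^bsub>K\<^esub>g\<in>carrier G. if p = g then ?c else \<zero>\<^bsub>K\<^esub>)"
    using xc p by (intro R.add.finprod_cong') (auto simp: ubasis_def)
  also have "\<dots> = ?c"
    using R.add.finprod_singleton[OF p(1) finite_arrows, of "\<lambda>_. ?c"] xc p by simp
  finally show ?thesis using p by (simp add: comult_def)
qed

text \<open>For a grouplike element the Sweedler sum has the single term (g, g). Arrows are thus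
  multiplicative, though they need not fix the unit.\<close>

lemma arrow_act_mult:
  assumes g: "g \<in> carrier G" and a: "a \<in> carrier B" and b: "b \<in> carrier B"
  shows "g \<rhd> (a \<otimes>\<^bsub>B\<^esub> b) = (g \<rhd> a) \<otimes>\<^bsub>B\<^esub> (g \<rhd> b)"
  unfolding act_on_mult[OF ubasis_closed a b]
proof (rule finsum_delta[where i = "(g, g)"])
  fix j assume "j \<in> carrier G \<times> carrier G"
  then show "(case j of (p, q) \<Rightarrow>
      comult K G (ubasis K G g) (p, q) \<odot>\<^bsub>B\<^esub> ((p \<rhd> a) \<otimes>\<^bsub>B\<^esub> (q \<rhd> b)))
    = (if j = (g, g) then (g \<rhd> a) \<otimes>\<^bsub>B\<^esub> (g \<rhd> b) else \<zero>\<^bsub>B\<^esub>)"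
    using a b by (auto simp: comult_eq[OF ubasis_closed] arrow_act_closed ubasis_apply split: if_split_asm)
qed (use g a b finite_arrows arrow_act_closed in auto)

text \<open>The unit of \<open>KG\<close> acts as the identity and its comultiplication is the sum of all
  \<open>u\<^sub>f \<otimes> u\<^sub>f\<close> over identities \<open>f\<close>, hence \<open>ab = \<Sum>\<^sub>f (f.a)(f.b)\<close>.\<close>

lemma mult_eq_zero_if_identities:
  assumes a: "a \<in> carrier B" and b: "b \<in> carrier B"
    and zero: "\<And>f. f \<in> carrier G \<Longrightarrow> src G f = f \<Longrightarrow> (f \<rhd> a) \<otimes>\<^bsub>B\<^esub> (f \<rhd> b) = \<zero>\<^bsub>B\<^esub>"
  shows "a \<otimes>\<^bsub>B\<^esub> b = \<zero>\<^bsub>B\<^esub>"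
proof -
  let ?one = "\<one>\<^bsub>groupoid_algebra K G\<^esub>"
  have one: "?one \<in> carrier (groupoid_algebra K G)"
    by (auto simp: groupoid_algebra_def)
  have "a \<otimes>\<^bsub>B\<^esub> b = finsum B (\<lambda>(p, q).
      comult K G ?one (p, q) \<odot>\<^bsub>B\<^esub> ((p \<rhd> a) \<otimes>\<^bsub>B\<^esub> (q \<rhd> b))) I"
    using act_on_mult[OF one a b] act_one a b by simp
  also have "\<dots> = \<zero>\<^bsub>B\<^esub>"
  proof (rule M.add.finprod_one_eqI, clarify)
    fix p q assume p: "p \<in> carrier G" "q \<in> carrier G"
    show "comult K G ?one (p, q) \<odot>\<^bsub>B\<^esub> ((p \<rhd> a) \<otimes>\<^bsub>B\<^esub> (q \<rhd> b)) = \<zero>\<^bsub>B\<^esub>"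
      unfolding comult_eq[OF one p]
      using p a b zero[of p] arrow_act_closed
      by (auto simp: groupoid_algebra_def identities_iff)
  qed
  finally show ?thesis .
qed

text \<open>Expand the product over the identities f. If f differs from \<open>e\<close>, then fe
  does not exist and f kills \<open>e \<rhd> b\<close>; if f is \<open>e\<close>, the left factor is
  zero.\<close>

lemma mult_identity_act_eq_zero:
  assumes e: "e \<in> carrier G" "src G e = e" and a: "a \<in> carrier B" "e \<rhd> a = \<zero>\<^bsub>B\<^esub>"
    and b: "b \<in> carrier B"
  shows "a \<otimes>\<^bsub>B\<^esub> (e \<rhd> b) = \<zero>\<^bsub>B\<^esub>"
proof (rule mult_eq_zero_if_identities)
  fix f assume f: "f \<in> carrier G" "src G f = f"
  show "(f \<rhd> a) \<otimes>\<^bsub>B\<^esub> (f \<rhd> e \<rhd> b) = \<zero>\<^bsub>B\<^esub>"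
  proof (cases "f = e")
    case True
    then show ?thesis using a b arrow_act_closed by simp
  next
    case False
    have "pcomp G f e = None"
      using pcomp_defined_iff[OF f(1) e(1)] tgt_src[OF f(1)] f e False by auto
    then show ?thesis
      using arrow_act_comp[OF f(1) e(1) b] a(1) arrow_act_closed by simp
  qed
qed (use a b arrow_act_closed in auto)

lemma src_act:
  assumes "g \<in> carrier G" "a \<in> carrier B"
  shows "src G g \<rhd> g \<rhd> a = g \<rhd> a"
  using arrow_act_comp[OF src_tgt_Some(3) _ assms(2)] assms pcomp_tgt(2) by simp

lemma act_tgt:
  assumes "g \<in> carrier G" "a \<in> carrier B"
  shows "g \<rhd> tgt G g \<rhd> a = g \<rhd> a"
  using arrow_act_comp[OF _ src_tgt_Some(4) assms(2)] assms pcomp_tgt(1) by simp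

lemma src_act_idem:
  assumes "g \<in> carrier G" "a \<in> carrier B"
  shows "src G g \<rhd> src G g \<rhd> a = src G g \<rhd> a"
  using src_act[OF src_tgt_Some(3)[OF assms(1)] assms(2)] src_src[OF assms(1)] by simp

text \<open>Every arrow \<open>g\<close> acts as an isomorphism between corners of \<open>B\<close> and thus carries the
  unit of one corner to the unit of the other.\<close>

lemma mult_act_one:
  assumes g: "g \<in> carrier G" and a: "a \<in> carrier B" and fixed: "src G g \<rhd> a = a"
  shows "a \<otimes>\<^bsub>B\<^esub> (g \<rhd> \<one>\<^bsub>B\<^esub>) = a"
proof -
  let ?b = "ginv G g \<rhd> a"
  have gb: "g \<rhd> ?b = a"
    using arrow_act_comp[OF g ginv_closed[OF g] a] src_tgt_Some(1)[OF g] fixed by simp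
  have "a \<otimes>\<^bsub>B\<^esub> (g \<rhd> \<one>\<^bsub>B\<^esub>) = g \<rhd> (?b \<otimes>\<^bsub>B\<^esub> \<one>\<^bsub>B\<^esub>)"
    using arrow_act_mult[OF g, of ?b "\<one>\<^bsub>B\<^esub>"] gb a arrow_act_closed by simp
  then show ?thesis using gb a arrow_act_closed by simp
qed

text \<open>Apply the multiplicative map \<open>src G g\<close> to the product of the unit and
  \<open>a\<close>, which it fixes.\<close>

lemma src_act_one_mult:
  assumes g: "g \<in> carrier G" and a: "a \<in> carrier B" and fixed: "src G g \<rhd> a = a"
  shows "(src G g \<rhd> \<one>\<^bsub>B\<^esub>) \<otimes>\<^bsub>B\<^esub> a = a"
  using arrow_act_mult[OF src_tgt_Some(3)[OF g], of "\<one>\<^bsub>B\<^esub>" a] a fixed by simp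

section \<open>The double smash product in coordinates\<close>

lemma double_smash_simps:
  "carrier A = I \<rightarrow>\<^sub>E carrier B"
  "\<zero>\<^bsub>A\<^esub> = (\<lambda>i\<in>I. \<zero>\<^bsub>B\<^esub>)"
  "x \<oplus>\<^bsub>A\<^esub> y = (\<lambda>i\<in>I. x i \<oplus>\<^bsub>B\<^esub> y i)"
  "c \<odot>\<^bsub>A\<^esub> x = (\<lambda>i\<in>I. c \<odot>\<^bsub>B\<^esub> x i)"
  by (simp_all add: double_smash_def)

lemma module_double_smash: "module K A"
proof (rule moduleI)
  show "abelian_group A"
  proof (rule abelian_groupI)
    fix x assume x: "x \<in> carrier A"
    show "\<exists>y\<in>carrier A. y \<oplus>\<^bsub>A\<^esub> x = \<zero>\<^bsub>A\<^esub>"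
      using x by (intro bexI[of _ "\<lambda>i\<in>I. \<ominus>\<^bsub>B\<^esub> x i"])
        (auto simp: double_smash_simps fun_eq_iff PiE_iff M.l_neg)
  qed (auto simp: double_smash_simps fun_eq_iff PiE_iff extensional_def M.a_assoc intro: M.a_comm)
qed (auto simp: double_smash_simps fun_eq_iff PiE_iff extensional_def
    R.is_cring smult_l_distr smult_r_distr smult_assoc1)

lemma submodule_PiE:
  assumes W: "\<And>i. i \<in> I \<Longrightarrow> submodule (W i) K B"
  shows "submodule (Pi\<^sub>E I W) K A"
proof -
  interpret D: module K A by (rule module_double_smash)
  note E = submoduleE[OF W]
  have zero: "\<zero>\<^bsub>B\<^esub> \<in> W i" if "i \<in> I" for i
    using subgroup.one_closed[OF submodule.axioms(1)[OF W[OF that]]] by simp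
  show ?thesis
  proof (rule D.submoduleI)
    show sub: "Pi\<^sub>E I W \<subseteq> carrier A"
      unfolding double_smash_simps by (rule PiE_mono) (rule E(1))
    show smult: "c \<odot>\<^bsub>A\<^esub> x \<in> Pi\<^sub>E I W" if "c \<in> carrier K" "x \<in> Pi\<^sub>E I W" for c x
      using that E(4) by (auto simp: double_smash_simps PiE_iff)
    \<comment> \<open>The negative in \<open>A\<close> is an abstract group inverse, not a
      coordinate formula, so it is reached as the multiple by -1.\<close>
    show "\<ominus>\<^bsub>A\<^esub> x \<in> Pi\<^sub>E I W" if x: "x \<in> Pi\<^sub>E I W" for x
    proof -
      have xc: "x \<in> carrier A" using x sub by blast
      have "(\<ominus>\<^bsub>K\<^esub> \<one>\<^bsub>K\<^esub>) \<odot>\<^bsub>A\<^esub> x = \<ominus>\<^bsub>A\<^esub> x"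
        using D.smult_l_minus[OF R.one_closed xc] D.smult_one[OF xc] by simp
      then show ?thesis using smult[OF _ x, of "\<ominus>\<^bsub>K\<^esub> \<one>\<^bsub>K\<^esub>"] by simp
    qed
  qed (use zero E(5) in \<open>auto simp: double_smash_simps PiE_iff\<close>)
qed

text \<open>Splittings are chosen coordinate by coordinate; uniqueness in each coordinate makes the
  choice by \<open>THE\<close> well defined.\<close>

lemma direct_sum_of_PiE:
  assumes ds: "\<And>i. i \<in> I \<Longrightarrow> direct_sum_of B (W i) (U i) (V i)"
  shows "direct_sum_of A (Pi\<^sub>E I W) (Pi\<^sub>E I U) (Pi\<^sub>E I V)"
  unfolding direct_sum_of_def
proof (intro conjI ballI)
  note d = ds[unfolded direct_sum_of_def]
  show "Pi\<^sub>E I U \<subseteq> Pi\<^sub>E I W" "Pi\<^sub>E I V \<subseteq> Pi\<^sub>E I W"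
    by (rule PiE_mono, use d in blast)+
  show "u \<oplus>\<^bsub>A\<^esub> v \<in> Pi\<^sub>E I W" if "u \<in> Pi\<^sub>E I U" "v \<in> Pi\<^sub>E I V" for u v
    using that d by (auto simp: PiE_iff double_smash_simps)
  fix s assume s: "s \<in> Pi\<^sub>E I W"
  have ex: "\<exists>!q. q \<in> U i \<times> V i \<and> s i = fst q \<oplus>\<^bsub>B\<^esub> snd q" if "i \<in> I" for i
    by (rule d[THEN conjunct2, THEN conjunct2, THEN conjunct2, THEN bspec, OF that PiE_mem[OF s that]])
  define q where "q i = (THE q. q \<in> U i \<times> V i \<and> s i = fst q \<oplus>\<^bsub>B\<^esub> snd q)" for i
  have q: "q i \<in> U i \<times> V i \<and> s i = fst (q i) \<oplus>\<^bsub>B\<^esub> snd (q i)" if "i \<in> I" for i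
    unfolding q_def using theI'[OF ex[OF that]] .
  show "\<exists>!p. p \<in> Pi\<^sub>E I U \<times> Pi\<^sub>E I V \<and> s = fst p \<oplus>\<^bsub>A\<^esub> snd p"
  proof (rule ex1I[of _ "(\<lambda>i\<in>I. fst (q i), \<lambda>i\<in>I. snd (q i))"])
    \<comment> \<open>Off \<open>I\<close> both sides have the default value
      \<open>undefined\<close>, so equality of functions holds there too.\<close>
    have "s i = (if i \<in> I then fst (q i) \<oplus>\<^bsub>B\<^esub> snd (q i) else undefined)" for i
      using q PiE_arb[OF s] by auto
    then show "(\<lambda>i\<in>I. fst (q i), \<lambda>i\<in>I. snd (q i)) \<in> Pi\<^sub>E I U \<times> Pi\<^sub>E I V \<and>
        s = fst (\<lambda>i\<in>I. fst (q i), \<lambda>i\<in>I. snd (q i)) \<oplus>\<^bsub>A\<^esub> snd (\<lambda>i\<in>I. fst (q i), \<lambda>i\<in>I. snd (q i))"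
      using q by (auto simp: double_smash_simps fun_eq_iff PiE_iff mem_Times_iff)
  next
    fix p assume p: "p \<in> Pi\<^sub>E I U \<times> Pi\<^sub>E I V \<and> s = fst p \<oplus>\<^bsub>A\<^esub> snd p"
    have q_eq: "q i = (fst p i, snd p i)" if i: "i \<in> I" for i
    proof -
      have "(fst p i, snd p i) \<in> U i \<times> V i" using p i by (auto simp: PiE_iff)
      moreover have "s i = fst (fst p i, snd p i) \<oplus>\<^bsub>B\<^esub> snd (fst p i, snd p i)"
        using p i by (simp add: double_smash_simps)
      ultimately show ?thesis
        unfolding q_def by (intro the1_equality[OF ex[OF i]] conjI)
    qed
    show "p = (\<lambda>i\<in>I. fst (q i), \<lambda>i\<in>I. snd (q i))"
      by (intro prod_eqI extensionalityI[of _ I]) (use p q_eq in \<open>auto simp: PiE_iff\<close>)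
  qed
qed

text \<open>The sum over \<open>h'\<close> and \<open>k\<close> collapses to \<open>h' = k = m\<close>, and \<open>hk\<^sup>-\<^sup>1 = g'\<close>
  is read as \<open>h = g'm\<close>.\<close>

lemma double_smash_coord:
  assumes F: "F \<in> carrier A" and F': "F' \<in> carrier A"
    and l: "l \<in> carrier G" and m: "m \<in> carrier G"
  shows "(F \<otimes>\<^bsub>A\<^esub> F') (l, m) =
    (\<Oplus>\<^bsub>B\<^esub>g\<in>carrier G. \<Oplus>\<^bsub>B\<^esub>h\<in>carrier G. \<Oplus>\<^bsub>B\<^esub>g'\<in>carrier G.
      if pcomp G g g' = Some l \<and> pcomp G g' m = Some h
      then F (g, h) \<otimes>\<^bsub>B\<^esub> (g \<rhd> F' (g', m)) else \<zero>\<^bsub>B\<^esub>)"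
proof -
  let ?u = "ubasis K G"
  have Fc: "F (g, h) \<in> carrier B" "F' (g, h) \<in> carrier B"
    if "g \<in> carrier G" "h \<in> carrier G" for g h
    using F F' that by (auto simp: double_smash_simps PiE_iff)
  let ?z = "\<lambda>h k. the (pcomp G h (ginv G k))"
  let ?T = "\<lambda>g h g' h' k. tens_dual K G B
             (tens G B (F (g, h)) (?u g) \<otimes>\<^bsub>smash K G B act\<^esub>
               dual_act K G B (rho K G (?z h k)) (tens G B (F' (g', h')) (?u g')))
             (conv K G (rho K G k) (rho K G h')) (l, m)"
  let ?Y = "\<lambda>g h g'. if pcomp G g g' = Some l \<and> pcomp G g' m = Some h
      then F (g, h) \<otimes>\<^bsub>B\<^esub> (g \<rhd> F' (g', m)) else \<zero>\<^bsub>B\<^esub>"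
  \<comment> \<open>Kronecker deltas meet here: the convolution forces \<open>k\<close> and
    \<open>h'\<close> to be \<open>m\<close>, the smash product forces gg' to be \<open>l\<close>,
    and \<open>rho\<close> at the quotient of \<open>h\<close> by \<open>k\<close> forces g'k to be
    \<open>h\<close>.\<close>
  have T: "?T g h g' h' k = (if k = m then if h' = m then ?Y g h g' else \<zero>\<^bsub>B\<^esub> else \<zero>\<^bsub>B\<^esub>)"
    if c: "g \<in> carrier G" "h \<in> carrier G" "g' \<in> carrier G" "h' \<in> carrier G" "k \<in> carrier G"
      and t: "tgt G k = tgt G h" for g h g' h' k
  proof -
    have "pcomp G h (ginv G k) \<noteq> None"
      using pcomp_defined_iff[OF c(2) ginv_closed[OF c(5)]] src_ginv[OF c(5)] t by simp
    then have z: "?z h k \<in> carrier G"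
      using pcomp_closed[OF c(2) ginv_closed[OF c(5)]] by auto
    let ?r = "rho K G (?z h k) (?u g')"
    have rc: "?r = (if pcomp G g' k = Some h then \<one>\<^bsub>K\<^esub> else \<zero>\<^bsub>K\<^esub>)"
      using rho_coord[OF z c(3)] pcomp_eq_iff[OF c(3,2,5)] t by simp
    have bc: "?r \<odot>\<^bsub>B\<^esub> F' (g', h') \<in> carrier B" using rc Fc c by simp
    have "dual_act K G B (rho K G (?z h k)) (tens G B (F' (g', h')) (?u g'))
        = tens G B (?r \<odot>\<^bsub>B\<^esub> F' (g', h')) (?u g')"
    proof (rule ext)
      fix j
      have "?u g' j = (if j = g' then \<one>\<^bsub>K\<^esub> else \<zero>\<^bsub>K\<^esub>)" if "j \<in> carrier G"
        using that by (simp add: ubasis_def)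
      then show "dual_act K G B (rho K G (?z h k)) (tens G B (F' (g', h')) (?u g')) j
        = tens G B (?r \<odot>\<^bsub>B\<^esub> F' (g', h')) (?u g') j"
        using Fc c z by (simp add: dual_act_def tens_def rho_coord)
    qed
    then have "?T g h g' h' k = tens_dual K G B (tens G B (F (g, h) \<otimes>\<^bsub>B\<^esub> (g \<rhd> (?r \<odot>\<^bsub>B\<^esub> F' (g', h'))))
        (?u g \<otimes>\<^bsub>groupoid_algebra K G\<^esub> ?u g')) (conv K G (rho K G k) (rho K G h')) (l, m)"
      using smash_mult[OF finite_groupoid c(1,3) Fc(1)[OF c(1,2)] bc] by simp
    also have "\<dots> = (rho K G k (?u m) \<otimes>\<^bsub>K\<^esub> rho K G h' (?u m)) \<odot>\<^bsub>B\<^esub>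
      ((?u g \<otimes>\<^bsub>groupoid_algebra K G\<^esub> ?u g') l \<odot>\<^bsub>B\<^esub> (F (g, h) \<otimes>\<^bsub>B\<^esub> (g \<rhd> (?r \<odot>\<^bsub>B\<^esub> F' (g', h')))))"
      using l m conv_coord[OF finite_groupoid c(5,4) m] by (simp add: tens_dual_def tens_def)
    also have "(?u g \<otimes>\<^bsub>groupoid_algebra K G\<^esub> ?u g') l
        = (if pcomp G g g' = Some l then \<one>\<^bsub>K\<^esub> else \<zero>\<^bsub>K\<^esub>)"
      using ubasis_mult[OF R.ring_axioms finite_groupoid c(1,3)] l
      by (auto simp: ubasis_def groupoid_algebra_def split: option.splits)
    finally show ?thesis
      using c m Fc arrow_act_closed act_zero[OF ubasis_closed] by (simp add: rc rho_coord)
  qed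
  have Yc: "?Y g h g' \<in> carrier B" if "g \<in> carrier G" "h \<in> carrier G" "g' \<in> carrier G" for g h g'
    using that Fc m arrow_act_closed by simp
  have k_sum: "finsum B (?T g h g' h') {k \<in> carrier G. tgt G k = tgt G h}
      = (if h' = m then ?Y g h g' else \<zero>\<^bsub>B\<^esub>)"
    if c: "g \<in> carrier G" "h \<in> carrier G" "g' \<in> carrier G" "h' \<in> carrier G" for g h g' h'
  proof (cases "tgt G m = tgt G h")
    case True
    show ?thesis
      by (rule finsum_delta[where i = m]) (use True T[OF c] Yc c m finite_arrows in auto)
  next
    case False
    \<comment> \<open>Here \<open>m\<close> is outside the range of the inner sum, but
      \<open>?Y\<close> vanishes as well: g'm = h would make the targets of \<open>m\<close> and
      \<open>h\<close> equal.\<close>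
    then have "?Y g h g' = \<zero>\<^bsub>B\<^esub>" using src_tgt_pcomp(2) c m by fastforce
    moreover have "finsum B (?T g h g' h') {k \<in> carrier G. tgt G k = tgt G h} = \<zero>\<^bsub>B\<^esub>"
      using False T[OF c] by (intro M.add.finprod_one_eqI) auto
    ultimately show ?thesis by simp
  qed
  have h'_sum: "(\<Oplus>\<^bsub>B\<^esub>h'\<in>carrier G. finsum B (?T g h g' h') {k \<in> carrier G. tgt G k = tgt G h})
      = ?Y g h g'"
    if c: "g \<in> carrier G" "h \<in> carrier G" "g' \<in> carrier G" for g h g'
    by (rule finsum_delta[where i = m]) (use k_sum[OF c] Yc[OF c] m finite_arrows in auto)
  have "(F \<otimes>\<^bsub>A\<^esub> F') (l, m) = (\<Oplus>\<^bsub>B\<^esub>g\<in>carrier G. \<Oplus>\<^bsub>B\<^esub>h\<in>carrier G. \<Oplus>\<^bsub>B\<^esub>g'\<in>carrier G.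
      \<Oplus>\<^bsub>B\<^esub>h'\<in>carrier G. finsum B (?T g h g' h') {k \<in> carrier G. tgt G k = tgt G h})"
    using l m by (simp add: double_smash_def)
  also have "\<dots> = (\<Oplus>\<^bsub>B\<^esub>g\<in>carrier G. \<Oplus>\<^bsub>B\<^esub>h\<in>carrier G. \<Oplus>\<^bsub>B\<^esub>g'\<in>carrier G. ?Y g h g')"
    using h'_sum Yc by (intro M.add.finprod_cong' M.add.finprod_closed refl) auto
  finally show ?thesis .
qed

lemma finsum_mem_submodule:
  assumes W: "submodule W K B" and f: "\<And>x. x \<in> X \<Longrightarrow> f x \<in> W"
  shows "finsum B f X \<in> W"
proof -
  have zero: "\<zero>\<^bsub>B\<^esub> \<in> W" using subgroup.one_closed[OF submodule.axioms(1)[OF W]] by simp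
  show ?thesis
  proof (cases "finite X")
    case True
    then show ?thesis using f
    proof (induction X rule: finite_induct)
      case (insert x X)
      moreover from insert have "f \<in> X \<rightarrow> carrier B" "f x \<in> carrier B"
        using submoduleE(1)[OF W] by auto
      ultimately show ?case using submoduleE(5)[OF W] by simp
    qed (simp add: zero)
  qed (simp add: zero M.add.finprod_infinite)
qed

text \<open>Each coordinate of a product is a sum of terms of one shape, so multiplicative claims
  reduce to single coefficients. Zero submodules give the vanishing of products.\<close>

lemma double_smash_mult_mem_PiE:
  assumes F: "F \<in> carrier A" and F': "F' \<in> carrier A"
    and W: "\<And>i. i \<in> I \<Longrightarrow> submodule (W i) K B"
    and mem: "\<And>g g' l m h. \<lbrakk>g \<in> carrier G; g' \<in> carrier G; l \<in> carrier G; m \<in> carrier G;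
      h \<in> carrier G; pcomp G g g' = Some l; pcomp G g' m = Some h\<rbrakk>
      \<Longrightarrow> F (g, h) \<otimes>\<^bsub>B\<^esub> (g \<rhd> F' (g', m)) \<in> W (l, m)"
  shows "F \<otimes>\<^bsub>A\<^esub> F' \<in> Pi\<^sub>E I W"
proof (rule PiE_I)
  fix i assume i: "i \<in> I"
  then obtain l m where lm: "i = (l, m)" "l \<in> carrier G" "m \<in> carrier G" by auto
  have zero: "\<zero>\<^bsub>B\<^esub> \<in> W (l, m)"
    using subgroup.one_closed[OF submodule.axioms(1)[OF W]] lm by simp
  show "(F \<otimes>\<^bsub>A\<^esub> F') i \<in> W i"
    unfolding lm(1) double_smash_coord[OF F F' lm(2,3)]
    by (intro finsum_mem_submodule W) (use lm mem zero in auto)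
qed (simp add: double_smash_def)

lemma submodule_zero: "submodule {\<zero>\<^bsub>B\<^esub>} K B"
  by (rule submoduleI) auto

lemma double_smash_mult_eq_zero:
  assumes "F \<in> carrier A" "F' \<in> carrier A"
    and "\<And>g g' l m h. \<lbrakk>g \<in> carrier G; g' \<in> carrier G; l \<in> carrier G; m \<in> carrier G;
      h \<in> carrier G; pcomp G g g' = Some l; pcomp G g' m = Some h\<rbrakk>
      \<Longrightarrow> F (g, h) \<otimes>\<^bsub>B\<^esub> (g \<rhd> F' (g', m)) = \<zero>\<^bsub>B\<^esub>"
  shows "F \<otimes>\<^bsub>A\<^esub> F' = \<zero>\<^bsub>A\<^esub>"
proof -
  have "F \<otimes>\<^bsub>A\<^esub> F' \<in> (\<Pi>\<^sub>E i\<in>I. {\<zero>\<^bsub>B\<^esub>})"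
    by (rule double_smash_mult_mem_PiE) (use assms submodule_zero in auto)
  then show ?thesis by (auto simp: double_smash_simps PiE_iff fun_eq_iff extensional_def)
qed

section \<open>Corners of the module algebra and the spaces S, S', T and D\<close>

text \<open>An identity \<open>e\<close> acts idempotently, so its fixed points form the image e.B,
  a ring with unit e.1.\<close>

definition corner :: "'g \<Rightarrow> 'b set" where
  "corner e = {a \<in> carrier B. e \<rhd> a = a}"

text \<open>The kernel of the action of \<open>e\<close>. For an identity it annihilates e.B from
  the left, by \<open>mult_identity_act_eq_zero\<close>.\<close>

definition annih :: "'g \<Rightarrow> 'b set" where
  "annih e = {a \<in> carrier B. e \<rhd> a = \<zero>\<^bsub>B\<^esub>}"

lemma arrow_act_minus:
  assumes "a \<in> carrier B" shows "g \<rhd> (\<ominus>\<^bsub>B\<^esub> a) = \<ominus>\<^bsub>B\<^esub> (g \<rhd> a)"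
proof -
  have m: "\<ominus>\<^bsub>B\<^esub> b = (\<ominus>\<^bsub>K\<^esub> \<one>\<^bsub>K\<^esub>) \<odot>\<^bsub>B\<^esub> b" if "b \<in> carrier B" for b
    using smult_l_minus[OF R.one_closed that] that by simp
  show ?thesis
    unfolding m[OF assms] m[OF arrow_act_closed[OF assms]]
    using act_smult_right[OF _ ubasis_closed assms] by simp
qed

lemma submodule_corner: "submodule (corner e) K B"
  by (rule submoduleI) (auto simp: corner_def act_zero[OF ubasis_closed] arrow_act_minus
      act_add_right[OF ubasis_closed] act_smult_right[OF _ ubasis_closed])

lemma submodule_annih: "submodule (annih e) K B"
  by (rule submoduleI) (auto simp: annih_def act_zero[OF ubasis_closed] arrow_act_minus
      act_add_right[OF ubasis_closed] act_smult_right[OF _ ubasis_closed])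

lemma direct_sum_of_corner_annih:
  assumes "g \<in> carrier G"
  shows "direct_sum_of B (carrier B) (corner (src G g)) (annih (src G g))"
  unfolding corner_def annih_def
  by (rule direct_sum_of_ker_fixed)
    (use assms in \<open>auto simp: arrow_act_closed act_add_right[OF ubasis_closed] src_act_idem\<close>)

abbreviation D_space :: "('g \<times> 'g \<Rightarrow> 'b) set" where
  "D_space \<equiv> (\<Pi>\<^sub>E (g, h)\<in>I. if tgt G g = src G h then {\<zero>\<^bsub>B\<^esub>} else carrier B)"

text \<open>The coefficient at \<open>g\<close> is attached to the source of \<open>g\<close>.
  Taking all of \<open>B\<close>, \<open>corner\<close> and \<open>annih\<close> for
  \<open>W\<close> yields S, S' and T.\<close>

abbreviation S_space :: "('g \<Rightarrow> 'b set) \<Rightarrow> ('g \<times> 'g \<Rightarrow> 'b) set" where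
  "S_space W \<equiv> (\<Pi>\<^sub>E (g, h)\<in>I. if tgt G g = src G h then W (src G g) else {\<zero>\<^bsub>B\<^esub>})"

lemma S_space_subset: "(\<And>e. W e \<subseteq> carrier B) \<Longrightarrow> S_space W \<subseteq> carrier A"
  by (fastforce simp: double_smash_simps PiE_iff split: if_splits)

lemma D_space_subset: "D_space \<subseteq> carrier A"
  by (fastforce simp: double_smash_simps PiE_iff split: if_splits)

lemma S_space_mem:
  assumes "F \<in> S_space W" "g \<in> carrier G" "h \<in> carrier G" "tgt G g = src G h"
  shows "F (g, h) \<in> W (src G g)"
  using assms by (force simp: PiE_iff)

lemma D_space_eq_zero:
  assumes "F \<in> D_space" "g \<in> carrier G" "h \<in> carrier G" "tgt G g = src G h"
  shows "F (g, h) = \<zero>\<^bsub>B\<^esub>"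
  using assms by (force simp: PiE_iff)

lemma submodule_S_space: "(\<And>e. submodule (W e) K B) \<Longrightarrow> submodule (S_space W) K A"
  by (rule submodule_PiE) (auto simp: submodule_zero)

lemma submodule_D_space: "submodule D_space K A"
  by (rule submodule_PiE) (auto simp: submodule_zero carrier_is_submodule)

text \<open>This bookkeeping is why D annihilates everything and S is closed: a contributing term
  reads both factors, and writes its result, at composable positions only. The last two equations
  tell which corners are involved.\<close>

lemma composable_mult:
  assumes "g \<in> carrier G" "g' \<in> carrier G" "m \<in> carrier G"
    and "pcomp G g g' = Some l" "pcomp G g' m = Some h"
  shows "tgt G g = src G h" "tgt G g' = src G m" "tgt G l = src G m"
    "src G l = src G g" "src G g' = tgt G g"
  using assms src_tgt_pcomp tgt_eq_src_if_pcomp by metis+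

text \<open>One arrow \<open>g\<close> suffices for the check: the second coefficient sits at an
  arrow with source t(g), and the result at one with source s(g).\<close>

lemma S_space_mult_mem:
  assumes W: "\<And>e. submodule (W e) K B" and F: "F \<in> S_space W" "F' \<in> S_space W"
    and mem: "\<And>g a b. \<lbrakk>g \<in> carrier G; a \<in> W (src G g); b \<in> W (tgt G g)\<rbrakk>
      \<Longrightarrow> a \<otimes>\<^bsub>B\<^esub> (g \<rhd> b) \<in> W (src G g)"
  shows "F \<otimes>\<^bsub>A\<^esub> F' \<in> S_space W"
proof (rule double_smash_mult_mem_PiE)
  show "F \<in> carrier A" "F' \<in> carrier A" using S_space_subset[of W] submoduleE(1)[OF W] F by blast+
next
  fix g g' l m h
  assume c: "g \<in> carrier G" "g' \<in> carrier G" "l \<in> carrier G" "m \<in> carrier G" "h \<in> carrier G"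
    and p: "pcomp G g g' = Some l" "pcomp G g' m = Some h"
  note cm = composable_mult[OF c(1,2,4) p]
  show "F (g, h) \<otimes>\<^bsub>B\<^esub> (g \<rhd> F' (g', m)) \<in> (case (l, m) of (g, h) \<Rightarrow>
      if tgt G g = src G h then W (src G g) else {\<zero>\<^bsub>B\<^esub>})"
    using S_space_mem[OF F(1) c(1,5) cm(1)] S_space_mem[OF F(2) c(2,4) cm(2)] mem[OF c(1)] cm by simp
qed (use W submodule_zero in auto)

lemma S_space_mult_eq_zero:
  assumes W: "\<And>e. W e \<subseteq> carrier B" "\<And>e. W' e \<subseteq> carrier B"
    and F: "F \<in> S_space W" "F' \<in> S_space W'"
    and zero: "\<And>g a b. \<lbrakk>g \<in> carrier G; a \<in> W (src G g); b \<in> W' (tgt G g)\<rbrakk>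
      \<Longrightarrow> a \<otimes>\<^bsub>B\<^esub> (g \<rhd> b) = \<zero>\<^bsub>B\<^esub>"
  shows "F \<otimes>\<^bsub>A\<^esub> F' = \<zero>\<^bsub>A\<^esub>"
proof (rule double_smash_mult_eq_zero)
  show "F \<in> carrier A" "F' \<in> carrier A" using S_space_subset[of W] S_space_subset[of W'] W F by blast+
next
  fix g g' l m h
  assume c: "g \<in> carrier G" "g' \<in> carrier G" "l \<in> carrier G" "m \<in> carrier G" "h \<in> carrier G"
    and p: "pcomp G g g' = Some l" "pcomp G g' m = Some h"
  note cm = composable_mult[OF c(1,2,4) p]
  show "F (g, h) \<otimes>\<^bsub>B\<^esub> (g \<rhd> F' (g', m)) = \<zero>\<^bsub>B\<^esub>"
    using S_space_mem[OF F(1) c(1,5) cm(1)] S_space_mem[OF F(2) c(2,4) cm(2)] zero[OF c(1)] cm by simp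
qed

lemma D_space_mult_eq_zero:
  assumes F: "F \<in> carrier A" and d: "d \<in> D_space"
  shows "F \<otimes>\<^bsub>A\<^esub> d = \<zero>\<^bsub>A\<^esub>" "d \<otimes>\<^bsub>A\<^esub> F = \<zero>\<^bsub>A\<^esub>"
proof -
  have dc: "d \<in> carrier A" using d D_space_subset by blast
  have Fc: "F (g, h) \<in> carrier B" if "g \<in> carrier G" "h \<in> carrier G" for g h
    using F that by (auto simp: double_smash_simps PiE_iff)
  show "F \<otimes>\<^bsub>A\<^esub> d = \<zero>\<^bsub>A\<^esub>"
  proof (rule double_smash_mult_eq_zero[OF F dc])
    fix g g' l m h
    assume c: "g \<in> carrier G" "g' \<in> carrier G" "l \<in> carrier G" "m \<in> carrier G" "h \<in> carrier G"
      and p: "pcomp G g g' = Some l" "pcomp G g' m = Some h"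
    show "F (g, h) \<otimes>\<^bsub>B\<^esub> (g \<rhd> d (g', m)) = \<zero>\<^bsub>B\<^esub>"
      using D_space_eq_zero[OF d c(2,4)] composable_mult[OF c(1,2,4) p] Fc[OF c(1,5)]
        act_zero[OF ubasis_closed] by simp
  qed
  show "d \<otimes>\<^bsub>A\<^esub> F = \<zero>\<^bsub>A\<^esub>"
  proof (rule double_smash_mult_eq_zero[OF dc F])
    fix g g' l m h
    assume c: "g \<in> carrier G" "g' \<in> carrier G" "l \<in> carrier G" "m \<in> carrier G" "h \<in> carrier G"
      and p: "pcomp G g g' = Some l" "pcomp G g' m = Some h"
    show "d (g, h) \<otimes>\<^bsub>B\<^esub> (g \<rhd> F (g', m)) = \<zero>\<^bsub>B\<^esub>"
      using D_space_eq_zero[OF d c(1,5)] composable_mult[OF c(1,2,4) p] Fc[OF c(2,4)]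
        arrow_act_closed by simp
  qed
qed

section \<open>The unit of S'\<close>

text \<open>In the matrix reading, \<open>g = src G h\<close> means row h and column h: this is the
  identity matrix whose diagonal entries are the units of the corners.\<close>

definition corner_unit :: "'g \<times> 'g \<Rightarrow> 'b" where
  "corner_unit = (\<lambda>(g, h)\<in>I. if g = src G h then src G h \<rhd> \<one>\<^bsub>B\<^esub> else \<zero>\<^bsub>B\<^esub>)"

lemma corner_unit_mem: "corner_unit \<in> S_space corner"
  by (auto simp: corner_unit_def corner_def tgt_src src_src src_act_idem arrow_act_closed
      act_zero[OF ubasis_closed])

text \<open>Isolates the one surviving term of the triple sum in
  \<open>double_smash_coord\<close>.\<close>

lemma finsum3_delta:
  assumes "i \<in> carrier G" "j \<in> carrier G" "k \<in> carrier G" "c \<in> carrier B"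
    and "\<And>x y z. \<lbrakk>x \<in> carrier G; y \<in> carrier G; z \<in> carrier G\<rbrakk>
      \<Longrightarrow> f x y z = (if x = i \<and> y = j \<and> z = k then c else \<zero>\<^bsub>B\<^esub>)"
  shows "(\<Oplus>\<^bsub>B\<^esub>x\<in>carrier G. \<Oplus>\<^bsub>B\<^esub>y\<in>carrier G. \<Oplus>\<^bsub>B\<^esub>z\<in>carrier G. f x y z) = c"
proof -
  have 1: "(\<Oplus>\<^bsub>B\<^esub>z\<in>carrier G. f x y z) = (if x = i \<and> y = j then c else \<zero>\<^bsub>B\<^esub>)"
    if "x \<in> carrier G" "y \<in> carrier G" for x y
    by (rule finsum_delta[where i = k]) (use assms that finite_arrows in auto)
  have 2: "(\<Oplus>\<^bsub>B\<^esub>y\<in>carrier G. \<Oplus>\<^bsub>B\<^esub>z\<in>carrier G. f x y z) = (if x = i then c else \<zero>\<^bsub>B\<^esub>)"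
    if "x \<in> carrier G" for x
    by (rule finsum_delta[where i = j]) (use assms 1 that finite_arrows in auto)
  show ?thesis
    by (rule finsum_delta[where i = i]) (use assms 2 finite_arrows in auto)
qed

lemma corner_unit_mult:
  assumes F: "F \<in> S_space corner"
  shows "corner_unit \<otimes>\<^bsub>A\<^esub> F = F" "F \<otimes>\<^bsub>A\<^esub> corner_unit = F"
proof -
  have sub: "S_space corner \<subseteq> carrier A"
    by (rule S_space_subset) (auto simp: corner_def)
  have Fc: "F \<in> carrier A" and uc: "corner_unit \<in> carrier A" using sub F corner_unit_mem by auto
  have FB: "F (g, h) \<in> carrier B" if "g \<in> carrier G" "h \<in> carrier G" for g h
    using Fc that by (auto simp: double_smash_simps PiE_iff)
  have out: "F (g, h) = \<zero>\<^bsub>B\<^esub>" if "g \<in> carrier G" "h \<in> carrier G" "tgt G g \<noteq> src G h" for g h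
    using F that by (force simp: PiE_iff)
  \<comment> \<open>At a non-composable position \<open>F\<close> is zero, so the equation holds
    there too.\<close>
  have inn: "src G g \<rhd> F (g, h) = F (g, h)" if "g \<in> carrier G" "h \<in> carrier G" for g h
    using S_space_mem[OF F that] out[OF that] act_zero[OF ubasis_closed]
    by (cases "tgt G g = src G h") (auto simp: corner_def)
  have ext: "x = F" if "x \<in> extensional I"
    "\<And>l m. l \<in> carrier G \<Longrightarrow> m \<in> carrier G \<Longrightarrow> x (l, m) = F (l, m)" for x
    using that F by (intro extensionalityI[of _ I]) (auto simp: PiE_iff)
  have left: "(corner_unit \<otimes>\<^bsub>A\<^esub> F) (l, m) = F (l, m)" if l: "l \<in> carrier G" and m: "m \<in> carrier G" for l m
  proof (cases "tgt G l = src G m")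
    case False
    \<comment> \<open>No term contributes, since the result position (l, m) of a contributing term
      would be composable.\<close>
    show ?thesis
      unfolding double_smash_coord[OF uc Fc l m] out[OF l m False]
      by (intro M.add.finprod_one_eqI) (use False composable_mult(3) m in auto)
  next
    case True
    \<comment> \<open>The surviving triple is (s(l), lm, l); \<open>h\<close> is its middle
      entry.\<close>
    then obtain h where h: "pcomp G l m = Some h" using pcomp_defined_iff[OF l m] by auto
    have hc: "h \<in> carrier G" and sh: "src G h = src G l"
      using pcomp_closed[OF l m h] src_tgt_pcomp[OF l m h] by auto
    show ?thesis
      unfolding double_smash_coord[OF uc Fc l m]
    proof (rule finsum3_delta[OF src_tgt_Some(3)[OF l] hc l FB[OF l m]])
      fix x y z assume c: "x \<in> carrier G" "y \<in> carrier G" "z \<in> carrier G"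
      \<comment> \<open>An identity \<open>x\<close> composable with \<open>z\<close> is the source
        of \<open>z\<close>, so xz is \<open>z\<close> itself.\<close>
      have e: "z = l" if "x = src G y" "pcomp G x z = Some l" "pcomp G z m = Some y"
        using that composable_mult[OF c(1,3) m that(2,3)] pcomp_tgt(2)[OF c(3)] tgt_src[OF c(2)] by simp
      show "(if pcomp G x z = Some l \<and> pcomp G z m = Some y
          then corner_unit (x, y) \<otimes>\<^bsub>B\<^esub> (x \<rhd> F (z, m)) else \<zero>\<^bsub>B\<^esub>)
        = (if x = src G l \<and> y = h \<and> z = l then F (l, m) else \<zero>\<^bsub>B\<^esub>)"
        using e c h sh FB[OF c(3) m] arrow_act_closed pcomp_tgt(2)[OF l] inn[OF l m]
          src_act_one_mult[OF l FB[OF l m]]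
        by (auto simp: corner_unit_def)
    qed
  qed
  have right: "(F \<otimes>\<^bsub>A\<^esub> corner_unit) (l, m) = F (l, m)" if l: "l \<in> carrier G" and m: "m \<in> carrier G" for l m
  proof (cases "tgt G l = src G m")
    case False
    show ?thesis
      unfolding double_smash_coord[OF Fc uc l m] out[OF l m False]
      by (intro M.add.finprod_one_eqI) (use False composable_mult(3) m in auto)
  next
    case True
    show ?thesis
      unfolding double_smash_coord[OF Fc uc l m]
    proof (rule finsum3_delta[OF l m src_tgt_Some(3)[OF m] FB[OF l m]])
      fix x y z assume c: "x \<in> carrier G" "y \<in> carrier G" "z \<in> carrier G"
      \<comment> \<open>With \<open>z\<close> an identity, xz is \<open>x\<close> and zm is
        \<open>m\<close>.\<close>
      have e: "x = l \<and> y = m" if "z = src G m" "pcomp G x z = Some l" "pcomp G z m = Some y"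
        using that composable_mult[OF c(1,3) m that(2,3)] pcomp_tgt(2)[OF m] pcomp_tgt(1)[OF c(1)]
          src_src[OF m] by simp
      \<comment> \<open>Since s(m) = t(l), the arrow \<open>l\<close> carries the unit of that
        corner to l.1, which \<open>mult_act_one\<close> absorbs into
        \<open>F (l, m)\<close>.\<close>
      have "l \<rhd> src G m \<rhd> \<one>\<^bsub>B\<^esub> = l \<rhd> \<one>\<^bsub>B\<^esub>" using act_tgt[OF l one_closed] True by simp
      then show "(if pcomp G x z = Some l \<and> pcomp G z m = Some y
          then F (x, y) \<otimes>\<^bsub>B\<^esub> (x \<rhd> corner_unit (z, m)) else \<zero>\<^bsub>B\<^esub>)
        = (if x = l \<and> y = m \<and> z = src G m then F (l, m) else \<zero>\<^bsub>B\<^esub>)"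
        using e c m FB[OF c(1,2)] arrow_act_closed pcomp_tgt(2)[OF m] pcomp_tgt(1)[OF l] True inn[OF l m]
          mult_act_one[OF l FB[OF l m]] act_zero[OF ubasis_closed]
        by (auto simp: corner_unit_def)
    qed
  qed
  show "corner_unit \<otimes>\<^bsub>A\<^esub> F = F" by (rule ext) (auto simp: left, simp add: double_smash_def)
  show "F \<otimes>\<^bsub>A\<^esub> corner_unit = F" by (rule ext) (auto simp: right, simp add: double_smash_def)
qed

text \<open>The coordinates at (f, f) give f.1 = 0 for all identities f, and 1 times 1 is the sum of
  the products (f.1)(f.1). This keeps S' nonzero when \<open>B\<close> is nonzero.\<close>

lemma corner_unit_eq_zero_imp_trivial:
  assumes "corner_unit = \<zero>\<^bsub>A\<^esub>"
  shows "\<one>\<^bsub>B\<^esub> = \<zero>\<^bsub>B\<^esub>"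
proof -
  have act_one_eq: "f \<rhd> \<one>\<^bsub>B\<^esub> = \<zero>\<^bsub>B\<^esub>" if f: "f \<in> carrier G" "src G f = f" for f
    using fun_cong[OF assms, of "(f, f)"] f by (simp add: corner_unit_def double_smash_simps)
  have "\<one>\<^bsub>B\<^esub> \<otimes>\<^bsub>B\<^esub> \<one>\<^bsub>B\<^esub> = \<zero>\<^bsub>B\<^esub>"
    by (rule mult_eq_zero_if_identities) (simp_all only: act_one_eq one_closed M.zero_closed r_null)
  then show ?thesis by simp
qed

section \<open>The decomposition of the double smash product\<close>

lemma double_smash_decomposition:
  shows "is_subalgebra K A (S_space (\<lambda>_. carrier B))"
    and "is_subalgebra K A (S_space corner)"
    and "has_unit A (S_space corner)"
    and "algebra_direct_sum_of K A (S_space (\<lambda>_. carrier B)) (S_space corner) (S_space annih)"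
    and "is_ideal K A D_space"
    and "direct_sum_of A (carrier A) D_space (S_space (\<lambda>_. carrier B))"
proof -
  interpret A: module K A by (rule module_double_smash)
  have corner: "corner e \<subseteq> carrier B" and annih: "annih e \<subseteq> carrier B" for e
    by (auto simp: corner_def annih_def)
  \<comment> \<open>As g.b equals s(g).(g.b), it lies in the image of s(g), which \<open>a\<close>
    annihilates.\<close>
  have annih_mult: "a \<otimes>\<^bsub>B\<^esub> (g \<rhd> b) = \<zero>\<^bsub>B\<^esub>"
    if "g \<in> carrier G" "a \<in> annih (src G g)" "b \<in> carrier B" for g a b
    using mult_identity_act_eq_zero[OF src_tgt_Some(3) src_src, of g a "g \<rhd> b"]
      that src_act arrow_act_closed by (simp add: annih_def)
  \<comment> \<open>Here g.b itself vanishes: it equals g.(t(g).b), and t(g) kills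
    \<open>b\<close>.\<close>
  have mult_annih: "a \<otimes>\<^bsub>B\<^esub> (g \<rhd> b) = \<zero>\<^bsub>B\<^esub>"
    if "g \<in> carrier G" "a \<in> carrier B" "b \<in> annih (tgt G g)" for g a b
  proof -
    have "g \<rhd> b = \<zero>\<^bsub>B\<^esub>"
      using act_tgt[of g b, symmetric] that act_zero[OF ubasis_closed] by (auto simp: annih_def)
    then show ?thesis using that(2) by simp
  qed
  show "is_subalgebra K A (S_space (\<lambda>_. carrier B))"
    unfolding is_subalgebra_def
  proof (intro conjI ballI)
    show "submodule (S_space (\<lambda>_. carrier B)) K A"
      by (rule submodule_S_space) (rule carrier_is_submodule)
  next
    fix x y assume "x \<in> S_space (\<lambda>_. carrier B)" "y \<in> S_space (\<lambda>_. carrier B)"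
    then show "x \<otimes>\<^bsub>A\<^esub> y \<in> S_space (\<lambda>_. carrier B)"
      by (intro S_space_mult_mem[where W = "\<lambda>_. carrier B"])
        (simp_all add: carrier_is_submodule arrow_act_closed)
  qed
  show sub_corner: "is_subalgebra K A (S_space corner)"
    unfolding is_subalgebra_def
  proof (intro conjI ballI)
    show "submodule (S_space corner) K A"
      by (rule submodule_S_space) (rule submodule_corner)
  next
    fix x y assume "x \<in> S_space corner" "y \<in> S_space corner"
    then show "x \<otimes>\<^bsub>A\<^esub> y \<in> S_space corner"
    proof (intro S_space_mult_mem[where W = corner])
      fix g a b assume "g \<in> carrier G" "a \<in> corner (src G g)" "b \<in> corner (tgt G g)"
      then show "a \<otimes>\<^bsub>B\<^esub> (g \<rhd> b) \<in> corner (src G g)"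
        by (simp add: corner_def arrow_act_closed arrow_act_mult src_tgt_Some(3) src_act)
    qed (simp_all add: submodule_corner)
  qed
  show "has_unit A (S_space corner)"
    unfolding has_unit_def by (intro bexI[OF _ corner_unit_mem] ballI conjI corner_unit_mult)
  \<comment> \<open>The family \<open>W\<close> stays free: \<open>annih\<close> gives the zero
    products within T, and \<open>corner\<close> the mixed ones.\<close>
  have annih_zero: "x \<otimes>\<^bsub>A\<^esub> y = \<zero>\<^bsub>A\<^esub>"
    if "\<And>e. W e \<subseteq> carrier B" "x \<in> S_space annih" "y \<in> S_space W" for x y W
    by (rule S_space_mult_eq_zero[OF annih that]) (use that(1) annih_mult in blast)
  have zero_annih: "x \<otimes>\<^bsub>A\<^esub> y = \<zero>\<^bsub>A\<^esub>"
    if "\<And>e. W e \<subseteq> carrier B" "x \<in> S_space W" "y \<in> S_space annih" for x y W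
    by (rule S_space_mult_eq_zero[OF that(1) annih that(2,3)]) (use that(1) mult_annih in blast)
  have sm_annih: "submodule (S_space annih) K A"
    by (rule submodule_S_space) (rule submodule_annih)
  have sub_annih: "is_subalgebra K A (S_space annih)"
    unfolding is_subalgebra_def
    using sm_annih annih_zero[of annih] annih subgroup.one_closed[OF submodule.axioms(1)[OF sm_annih]]
    by simp
  have "direct_sum_of A (S_space (\<lambda>_. carrier B)) (S_space corner) (S_space annih)"
  proof (rule direct_sum_of_PiE, clarify)
    fix g h assume "g \<in> carrier G" "h \<in> carrier G"
    then show "direct_sum_of B
        (if tgt G g = src G h then carrier B else {\<zero>\<^bsub>B\<^esub>})
        (if tgt G g = src G h then corner (src G g) else {\<zero>\<^bsub>B\<^esub>})
        (if tgt G g = src G h then annih (src G g) else {\<zero>\<^bsub>B\<^esub>})"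
      using direct_sum_of_corner_annih direct_sum_of_zero(1)[of "{\<zero>\<^bsub>B\<^esub>}"] by simp
  qed
  then show "algebra_direct_sum_of K A (S_space (\<lambda>_. carrier B)) (S_space corner) (S_space annih)"
    unfolding algebra_direct_sum_of_def
    using sub_corner sub_annih
    by (intro conjI ballI annih_zero[OF corner] zero_annih[OF corner])
  show "is_ideal K A D_space"
    unfolding is_ideal_def
    using submodule_D_space D_space_mult_eq_zero
      subgroup.one_closed[OF submodule.axioms(1)[OF submodule_D_space]] by simp
  \<comment> \<open>At every position one summand is zero and the other is all of
    \<open>B\<close>.\<close>
  have "direct_sum_of A (I \<rightarrow>\<^sub>E carrier B) D_space (S_space (\<lambda>_. carrier B))"
    by (rule direct_sum_of_PiE) (simp add: case_prod_unfold direct_sum_of_zero)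
  then show "direct_sum_of A (carrier A) D_space (S_space (\<lambda>_. carrier B))"
    by (simp add: double_smash_simps)
qed

end

theorem theorem2p6:
  fixes K :: "('k, 'm) ring_scheme" and G :: "'g pgroupoid"
    and B :: "('k, 'b, 'n) module_scheme" and act :: "('g \<Rightarrow> 'k) \<Rightarrow> 'b \<Rightarrow> 'b"
  assumes "field K" and "finite_groupoid G" and "weak_module_algebra K G B act"
  shows "let A = double_smash K G B act in \<exists>S S' T D.
      is_subalgebra K A S \<and>
      is_subalgebra K A S' \<and> S' \<subseteq> S \<and> has_unit A S' \<and>
      (\<one>\<^bsub>B\<^esub> \<noteq> \<zero>\<^bsub>B\<^esub> \<longrightarrow> S' \<noteq> {\<zero>\<^bsub>A\<^esub>}) \<and>
      algebra_direct_sum_of K A S S' T \<and>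
      is_ideal K A D \<and>
      direct_sum_of A (carrier A) D S"
proof -
  interpret weak_module_algebra K G B act by fact
  interpret finite_groupoid G by fact
  interpret groupoid_weak_module_algebra K G B act ..
  have "S_space corner \<subseteq> S_space (\<lambda>_. carrier B)"
    using double_smash_decomposition(4)
    unfolding algebra_direct_sum_of_def direct_sum_of_def by (elim conjE)
  \<comment> \<open>\<open>corner_unit\<close> lies in S', so S' = 0 would force it to be
    zero.\<close>
  moreover have "S_space corner \<noteq> {\<zero>\<^bsub>A\<^esub>}" if "\<one>\<^bsub>B\<^esub> \<noteq> \<zero>\<^bsub>B\<^esub>"
    using that corner_unit_mem corner_unit_eq_zero_imp_trivial by (metis singletonD)
  ultimately show ?thesis
    unfolding Let_def
    by (intro exI[of _ "S_space (\<lambda>_. carrier B)"] exI[of _ "S_space corner"]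
        exI[of _ "S_space annih"] exI[of _ D_space] conjI impI double_smash_decomposition)
qed

end
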